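(* Let $G_3$ be the group with generators $a_1,b_1,a_2,b_2,c_1$ and defining relations $$[a_1,b_1]=[a_2,b_2]=1,\quad b_1^{c_1}=b_1^{a_2},\quad a_1^{c_1}=a_1^{b_2},\quad b_2^{c_1}=b_2^{a_1b_2},\quad a_2^{c_1}=a_2^{b_1a_2}.$$ Its abelianization is free abelian with basis the classes of $a_1,b_1,a_2,b_2,c_1$; let $a_1^*,b_1^*,a_2^*,b_2^*,c_1^*\in H^1(G_3;\mathbb{Z})$ be the dual basis. Then the integral cohomology ring $H^*(G_3;\mathbb{Z})$ is the quotient of the exterior algebra $E(a_1^*,b_1^*,a_2^*,b_2^*,c_1^* )$ (over $\mathbb{Z}$) by the four relations $$a_1^*c_1^*+a_1^*b_2^*+c_1^*b_2^*=0,\qquad b_1^*c_1^*+b_1^*a_2^*+c_1^*a_2^*=0,\qquad a_1^*a_2^*=0,\qquad b_1^*b_2^*=0.$$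
   Context: $y^x=x^{-1}yx$ and $[x,y]=x^{-1}y^{-1}xy$. *)

theory Defs
  imports Main
begin

text \<open>Generators: 0 = a1, 1 = b1, 2 = a2, 3 = b2, 4 = c1.
  A letter (i, False) is the generator i, (i, True) is its inverse.\<close>

type_synonym letter = "nat \<times> bool"
type_synonym word = "letter list"

definition gen :: "nat \<Rightarrow> word" where "gen i = [(i, False)]"

definition inv_letter :: "letter \<Rightarrow> letter" where
  "inv_letter l = (fst l, \<not> snd l)"

definition inv_word :: "word \<Rightarrow> word" where
  "inv_word w = rev (map inv_letter w)"

definition conj :: "word \<Rightarrow> word \<Rightarrow> word" where
  "conj x y = inv_word y @ x @ y"

definition comm :: "word \<Rightarrow> word \<Rightarrow> word" where
  "comm x y = inv_word x @ inv_word y @ x @ y"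

definition eqrel :: "word \<Rightarrow> word \<Rightarrow> word" where
  "eqrel u v = u @ inv_word v"

abbreviation "a1 \<equiv> gen 0"
abbreviation "b1 \<equiv> gen 1"
abbreviation "a2 \<equiv> gen 2"
abbreviation "b2 \<equiv> gen 3"
abbreviation "c1 \<equiv> gen 4"

definition relators :: "word set" where
  "relators = {comm a1 b1, comm a2 b2,
               eqrel (conj b1 c1) (conj b1 a2),
               eqrel (conj a1 c1) (conj a1 b2),
               eqrel (conj b2 c1) (conj b2 (a1 @ b2)),
               eqrel (conj a2 c1) (conj a2 (b1 @ a2))}"

definition valid :: "word \<Rightarrow> bool" where
  "valid w \<longleftrightarrow> (\<forall>l\<in>set w. fst l < 5)"

definition valid_list :: "word list \<Rightarrow> bool" where
  "valid_list xs \<longleftrightarrow> (\<forall>w\<in>set xs. valid w)"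

text \<open>Equality in G3: the congruence on words generated by free cancellation
  and the defining relators (i.e. modulo the normal closure of the relators).\<close>
inductive eqw :: "word \<Rightarrow> word \<Rightarrow> bool" where
  refl: "eqw w w"
| sym: "eqw u v \<Longrightarrow> eqw v u"
| trans: "eqw u v \<Longrightarrow> eqw v w \<Longrightarrow> eqw u w"
| cancel: "eqw (u @ [l, inv_letter l] @ v) (u @ v)"
| rel: "r \<in> relators \<Longrightarrow> eqw (u @ r @ v) (u @ v)"

inductive eqab :: "word \<Rightarrow> word \<Rightarrow> bool" where
  refl: "eqab w w"
| sym: "eqab u v \<Longrightarrow> eqab v u"
| trans: "eqab u v \<Longrightarrow> eqab v w \<Longrightarrow> eqab u w"
| cancel: "eqab (u @ [l, inv_letter l] @ v) (u @ v)"
| rel: "r \<in> relators \<Longrightarrow> eqab (u @ r @ v) (u @ v)"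
| swap: "eqab (u @ [l, l'] @ v) (u @ [l', l] @ v)"

text \<open>Exponent sum of generator i; on G3 this is the dual class of generator i
  in H^1(G3;Z) = Hom(G3,Z).\<close>
definition expsum :: "nat \<Rightarrow> word \<Rightarrow> int" where
  "expsum i w = (\<Sum>l\<leftarrow>w. if fst l = i then (if snd l then -1 else 1) else 0)"

text \<open>An n-cochain is a function on n-tuples of group elements, represented
  as a function on lists of words that respects_eq equality in G3.\<close>
definition respects_eq :: "(word list \<Rightarrow> int) \<Rightarrow> bool" where
  "respects_eq f \<longleftrightarrow> (\<forall>xs ys. valid_list xs \<and> valid_list ys \<and> list_all2 eqw xs ys
                      \<longrightarrow> f xs = f ys)"

definition merge :: "nat \<Rightarrow> word list \<Rightarrow> word list" where
  "merge i xs = take (i - 1) xs @ [xs ! (i - 1) @ xs ! i] @ drop (i + 1) xs"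

definition delta :: "nat \<Rightarrow> (word list \<Rightarrow> int) \<Rightarrow> word list \<Rightarrow> int" where
  "delta n f xs = f (tl xs) + (\<Sum>i=1..n. (-1) ^ i * f (merge i xs))
                  + (-1) ^ (n + 1) * f (take n xs)"

definition cocycle :: "nat \<Rightarrow> (word list \<Rightarrow> int) \<Rightarrow> bool" where
  "cocycle n f \<longleftrightarrow> respects_eq f \<and>
     (\<forall>xs. valid_list xs \<and> length xs = n + 1 \<longrightarrow> delta n f xs = 0)"

definition coboundary :: "nat \<Rightarrow> (word list \<Rightarrow> int) \<Rightarrow> bool" where
  "coboundary n f \<longleftrightarrow> (\<exists>h. respects_eq h \<and>
     (\<forall>xs. valid_list xs \<and> length xs = n \<longrightarrow>
            f xs = (if n = 0 then 0 else delta (n - 1) h xs)))"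

definition cohomologous :: "nat \<Rightarrow> (word list \<Rightarrow> int) \<Rightarrow> (word list \<Rightarrow> int) \<Rightarrow> bool" where
  "cohomologous n f g \<longleftrightarrow> coboundary n (\<lambda>xs. f xs - g xs)"

definition cup :: "nat \<Rightarrow> (word list \<Rightarrow> int) \<Rightarrow> (word list \<Rightarrow> int) \<Rightarrow> word list \<Rightarrow> int" where
  "cup p f g xs = f (take p xs) * g (drop p xs)"

definition dual :: "nat \<Rightarrow> word list \<Rightarrow> int" where
  "dual i xs = expsum i (hd xs)"

fun cupmono :: "nat list \<Rightarrow> word list \<Rightarrow> int" where
  "cupmono [] = (\<lambda>xs. 1)"
| "cupmono (i # is) = cup 1 (dual i) (cupmono is)"

text \<open>An element is a function assigning to each subset S of {0..<5} the
  coefficient of the monomial e_S = x_{s1} ... x_{sk} (s1 < ... < sk).\<close>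
type_synonym ext = "nat set \<Rightarrow> int"

definition ext_deg :: "nat \<Rightarrow> ext \<Rightarrow> bool" where
  "ext_deg n u \<longleftrightarrow> (\<forall>S. u S \<noteq> 0 \<longrightarrow> S \<subseteq> {0..<5} \<and> card S = n)"

definition shuffle_sign :: "nat set \<Rightarrow> nat set \<Rightarrow> int" where
  "shuffle_sign S R = (-1) ^ card {(s, r). s \<in> S \<and> r \<in> R \<and> r < s}"

definition wedge :: "ext \<Rightarrow> ext \<Rightarrow> ext" where
  "wedge u v T = (\<Sum>S\<in>Pow T. shuffle_sign S (T - S) * u S * v (T - S))"

definition ext_add :: "ext \<Rightarrow> ext \<Rightarrow> ext" where
  "ext_add u v S = u S + v S"

definition xgen :: "nat \<Rightarrow> ext" where
  "xgen i S = (if S = {i} then 1 else 0)"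

definition rel1 :: ext where
  "rel1 = ext_add (ext_add (wedge (xgen 0) (xgen 4)) (wedge (xgen 0) (xgen 3)))
                  (wedge (xgen 4) (xgen 3))"
definition rel2 :: ext where
  "rel2 = ext_add (ext_add (wedge (xgen 1) (xgen 4)) (wedge (xgen 1) (xgen 2)))
                  (wedge (xgen 4) (xgen 2))"
definition rel3 :: ext where "rel3 = wedge (xgen 0) (xgen 2)"
definition rel4 :: ext where "rel4 = wedge (xgen 1) (xgen 3)"

text \<open>Degree-n part of the (two-sided, homogeneous) ideal generated by the relations;
  since E is graded commutative and the relations are homogeneous of degree 2,
  it consists of the sums u1 r1 + ... + u4 r4 with ui of degree n-2.\<close>
definition ideal_deg :: "nat \<Rightarrow> ext \<Rightarrow> bool" where
  "ideal_deg n z \<longleftrightarrow> (if n < 2 then (\<forall>S. z S = 0) else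
     (\<exists>u1 u2 u3 u4. ext_deg (n - 2) u1 \<and> ext_deg (n - 2) u2 \<and>
        ext_deg (n - 2) u3 \<and> ext_deg (n - 2) u4 \<and>
        z = ext_add (ext_add (wedge u1 rel1) (wedge u2 rel2))
                    (ext_add (wedge u3 rel3) (wedge u4 rel4))))"

definition phi :: "nat \<Rightarrow> ext \<Rightarrow> word list \<Rightarrow> int" where
  "phi n u xs = (\<Sum>S\<in>{S. S \<subseteq> {0..<5} \<and> card S = n}.
                   u S * cupmono (sorted_list_of_set S) xs)"

end

theory Submission
  imports Defs
begin

text \<open>Let \<open>N\<close> be the subgroup of \<open>G\<^sub>3\<close> generated by \<open>b1, b2, c1\<close>. The relators
  say that \<open>a1\<close> and \<open>a2\<close> act on \<open>N\<close> by conjugation, and \<open>G\<^sub>3\<close> is a semidirect product of a free group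
  \<open>N\<close> of rank 3 with a free group of rank 2; only the freeness of \<open>N\<close> is needed.

  An \<open>n\<close>-cocycle \<open>f\<close> gives a function on the edges of the Cayley graph with values in functions of the
  remaining arguments; its sums around the relator loops obstruct the integration of this function to
  a cochain \<open>e\<close> for which \<open>f - \<delta> e\<close> does not depend on its first argument, and a cocycle of the latter
  kind is a coboundary. The edge function may be changed by cocycles in the remaining arguments.
  For \<open>n = 2\<close> the loop sums are six integers, which identify \<open>H\<^sup>2\<close> with \<open>\<int>\<^sup>6\<close>; on products of degree one
  classes their common kernel is spanned by the four relations. For \<open>n \<ge> 3\<close> the loop sums are
  themselves coboundaries, and to remove them one changes the edge function on \<open>a1\<close>-edges and
  \<open>a2\<close>-edges only. The relators prescribe the differences of the change along the generators of
  \<open>N\<close>, and such a problem is always solvable since \<open>N\<close> is free and acts freely on \<open>G\<^sub>3\<close>. Hence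
  \<open>H\<^sup>n = 0\<close> for \<open>n \<ge> 3\<close>, in accordance with the ideal of relations being everything in these
  degrees.\<close>

section \<open>Words and the action on the free normal subgroup\<close>

lemma inv_letter_inv [simp]: "inv_letter (inv_letter l) = l"
  by (simp add: inv_letter_def)

lemma inv_word_append [simp]: "inv_word (u @ v) = inv_word v @ inv_word u"
  by (simp add: inv_word_def)

lemma inv_word_Nil [simp]: "inv_word [] = []"
  by (simp add: inv_word_def)

lemma inv_word_Cons: "inv_word (l # w) = inv_word w @ [inv_letter l]"
  by (simp add: inv_word_def)

lemma inv_word_inv [simp]: "inv_word (inv_word w) = w"
  by (induction w) (simp_all add: inv_word_def rev_map comp_def)

section \<open>Free equality of words and equality in the group\<close>

inductive feq :: "word \<Rightarrow> word \<Rightarrow> bool" where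
  feq_refl: "feq w w"
| feq_sym: "feq u v \<Longrightarrow> feq v u"
| feq_trans: "feq u v \<Longrightarrow> feq v w \<Longrightarrow> feq u w"
| feq_cancel: "feq (u @ [l, inv_letter l] @ v) (u @ v)"

lemma feq_imp_eqw: "feq u v \<Longrightarrow> eqw u v"
  by (induction rule: feq.induct) (blast intro: eqw.intros)+

lemma feq_append: "feq u u' \<Longrightarrow> feq (p @ u @ q) (p @ u' @ q)"
proof (induction rule: feq.induct)
  case (feq_cancel u l v)
  show ?case using feq.feq_cancel[of "p @ u" l "v @ q"] by simp
qed (blast intro: feq.intros)+

lemma feq_append2: "feq u u' \<Longrightarrow> feq v v' \<Longrightarrow> feq (u @ v) (u' @ v')"
  using feq_append[of u u' "[]" v] feq_append[of v v' u' "[]"] by (auto intro: feq_trans)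

lemma eqw_append: "eqw u u' \<Longrightarrow> eqw (p @ u @ q) (p @ u' @ q)"
proof (induction rule: eqw.induct)
  case (cancel u l v)
  show ?case using eqw.cancel[of "p @ u" l "v @ q"] by simp
next
  case (rel r u v)
  then show ?case using eqw.rel[of r "p @ u" "v @ q"] by simp
qed (blast intro: eqw.intros)+

lemma eqw_append2: "eqw u u' \<Longrightarrow> eqw v v' \<Longrightarrow> eqw (u @ v) (u' @ v')"
  using eqw_append[of u u' "[]" v] eqw_append[of v v' u' "[]"] by (auto intro: eqw.trans)

lemma feq_inv_word: "feq u v \<Longrightarrow> feq (inv_word u) (inv_word v)"
proof (induction rule: feq.induct)
  case (feq_cancel u l v)
  show ?case using feq.feq_cancel[of "inv_word v" l "inv_word u"] by (simp add: inv_word_Cons)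
qed (blast intro: feq.intros)+

lemma feq_right_inv: "feq (w @ inv_word w) []"
proof (induction w)
  case (Cons l w)
  have "feq ([l] @ (w @ inv_word w) @ [inv_letter l]) ([l] @ [] @ [inv_letter l])"
    by (rule feq_append[OF Cons])
  also have "feq \<dots> []" using feq_cancel[of "[]" l "[]"] by simp
  finally (feq_trans) show ?case by (simp add: inv_word_Cons)
qed (simp add: feq_refl)

lemma feq_left_inv: "feq (inv_word w @ w) []"
  using feq_right_inv[of "inv_word w"] by simp

lemma eqw_cancel_left: "eqw (w @ inv_word w @ z) z" "eqw (inv_word w @ w @ z) z"
  using eqw_append2[OF feq_imp_eqw[OF feq_right_inv[of w]] eqw.refl[of z]]
    eqw_append2[OF feq_imp_eqw[OF feq_left_inv[of w]] eqw.refl[of z]] by simp_all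

lemma eqw_solve_left:
  assumes "eqw (u @ v) []" shows "eqw (v @ z) (inv_word u @ z)"
proof -
  have "eqw (v @ z) (inv_word u @ u @ v @ z)" by (rule eqw.sym, rule eqw_cancel_left)
  moreover have "eqw (inv_word u @ (u @ v) @ z) (inv_word u @ [] @ z)" by (rule eqw_append[OF assms])
  ultimately show ?thesis by (auto intro: eqw.trans)
qed

fun push :: "letter \<Rightarrow> word \<Rightarrow> word" where
  "push l [] = [l]"
| "push l (m # w) = (if m = inv_letter l then w else l # m # w)"

lemma feq_push: "feq (push l w) (l # w)"
  using feq_cancel[of "[]" l] by (cases w) (auto intro: feq_refl feq_sym)

lemma feq_reduce: "feq (foldr push w []) w"
proof (induction w)
  case (Cons l w)
  have "feq (foldr push (l # w) []) ([l] @ foldr push w [])" using feq_push by simp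
  also have "feq \<dots> ([l] @ w)" by (rule feq_append2[OF feq_refl Cons])
  finally (feq_trans) show ?case by simp
qed (simp add: feq_refl)

text \<open>\<open>push\<close> cancels at the front of a reduced word, so the fold computes reduced
  forms, and free equalities of concrete words follow by evaluation.\<close>

lemma feqI: "foldr push u [] = foldr push v [] \<Longrightarrow> feq u v"
  by (metis feq_reduce feq_sym feq_trans)

section \<open>Substitutions as endomorphisms of the free group\<close>

definition subst :: "(nat \<Rightarrow> word) \<Rightarrow> word \<Rightarrow> word" where
  "subst t w = concat (map (\<lambda>(i, s). if s then inv_word (t i) else t i) w)"

lemma subst_Nil [simp]: "subst t [] = []"
  by (simp add: subst_def)

lemma subst_Cons [simp]: "subst t ((i, s) # w) = (if s then inv_word (t i) else t i) @ subst t w"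
  by (simp add: subst_def)

lemma subst_append [simp]: "subst t (u @ v) = subst t u @ subst t v"
  by (simp add: subst_def)

lemma subst_feq: "feq u v \<Longrightarrow> feq (subst t u) (subst t v)"
proof (induction rule: feq.induct)
  case (feq_cancel u l v)
  have "feq (subst t [l, inv_letter l]) []"
    by (cases l) (auto simp: inv_letter_def feq_left_inv feq_right_inv)
  from feq_append[OF this, of "subst t u" "subst t v"] show ?case
    by (metis append_Nil subst_append)
qed (blast intro: feq.intros)+

lemma subst_inv_word: "subst t (inv_word w) = inv_word (subst t w)"
  by (induction w) (auto simp: inv_word_Cons inv_letter_def)

text \<open>An endomorphism is determined by its values on the generators.\<close>

lemma subst_subst_cancel:
  assumes "\<And>i. feq (subst s (t i)) [(i, False)]"
  shows "feq (subst s (subst t w)) w"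
proof (induction w)
  case (Cons l w)
  obtain i b where l: "l = (i, b)" by force
  have "feq (subst s (inv_word (t i))) [(i, True)]"
    using feq_inv_word[OF assms[of i]] by (simp add: subst_inv_word inv_word_Cons inv_letter_def)
  with assms[of i] have "feq (subst s (if b then inv_word (t i) else t i)) [l]" by (auto simp: l)
  from feq_append2[OF this Cons] show ?case by (simp add: l)
qed (simp add: feq_refl)

text \<open>The normal subgroup of \<open>G\<^sub>3\<close> generated by \<open>b1, b2, c1\<close> is free on these
  elements; \<open>twist i False\<close> and \<open>twist i True\<close> are the automorphisms \<open>x \<mapsto> a x a\<inverse>\<close> and
  \<open>x \<mapsto> a\<inverse> x a\<close> of it for the generator \<open>a\<close> with index \<open>i \<in> {0, 2}\<close>.\<close>

definition twist :: "nat \<Rightarrow> bool \<Rightarrow> nat \<Rightarrow> word" where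
  "twist i s j =
    (if i = 0 \<and> j = 3 then
       (if s then conj b2 (c1 @ inv_word b2) else conj b2 (inv_word c1))
     else if i = 0 \<and> j = 4 then
       (if s then conj c1 (inv_word b2) else conj c1 (b2 @ inv_word c1))
     else if i = 2 \<and> j = 1 then
       (if s then conj b1 c1 else conj b1 (inv_word c1 @ b1))
     else if i = 2 \<and> j = 4 then
       (if s then conj c1 (inv_word b1 @ c1) else conj c1 b1)
     else gen j)"

text \<open>By the relators, conjugation by \<open>a1\<close> fixes b1 and c1 b2^-1, and conjugation
  by \<open>a2\<close> fixes b2 and b1^-1 c1. Solving for the images of the other generators gives
  the formulas of \<open>twist\<close>, which are inverse to each other on each generator.\<close>

lemma twist_twist: "feq (subst (twist i s) (twist i (\<not> s) j)) [(j, False)]"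
  by (rule feqI) (auto simp: twist_def conj_def gen_def inv_word_def inv_letter_def)

text \<open>The action of \<open>G\<^sub>3\<close> on the cosets of the subgroup generated by \<open>a1, a2\<close>, identified with the free
  normal subgroup; words are not reduced, so it is an action only up to \<open>feq\<close>.\<close>

fun free_act :: "word \<Rightarrow> word \<Rightarrow> word" where
  "free_act [] w = w"
| "free_act ((i, s) # z) w =
     (if i = 0 \<or> i = 2 then subst (twist i s) (free_act z w) else (i, s) # free_act z w)"

lemma free_act_append: "free_act (u @ v) w = free_act u (free_act v w)"
  by (induction u w rule: free_act.induct) auto

lemma free_act_feq: "feq w w' \<Longrightarrow> feq (free_act z w) (free_act z w')"
proof (induction z w rule: free_act.induct)
  case (2 i s z w)
  then show ?case
    using feq_append2[OF feq_refl[of "[(i, s)]"]] by (auto intro: subst_feq)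
qed auto

lemma free_act_cancel: "feq (free_act [l, inv_letter l] w) w"
proof (cases l)
  case (Pair i s)
  show ?thesis
  proof (cases "i = 0 \<or> i = 2")
    case True
    then show ?thesis using subst_subst_cancel[OF twist_twist, of i s w]
      by (auto simp: Pair inv_letter_def)
  next
    case False
    then show ?thesis using feq_cancel[of "[]" l w] by (auto simp: Pair inv_letter_def)
  qed
qed

lemma feq_rev_start: "feq (rev [] @ x) w \<Longrightarrow> feq x w"
  by simp

lemma feq_rev_step: "feq (rev (l # u) @ x) w \<Longrightarrow> feq (rev u @ l # x) w"
  by simp

lemma feq_rev_end:
  assumes "foldr push (rev u) [] = []" "feq x w"
  shows "feq (rev u @ x) w"
  using feq_append2[OF feqI[of "rev u" "[]"] assms(2)] assms(1) by simp

lemma subst_twist_twist: "feq (subst (twist i s) (subst (twist i (\<not> s)) w)) w"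
  by (rule subst_subst_cancel[OF twist_twist])

lemma subst_twist_cancel:
  "feq (subst (twist i True) (subst (twist i False) w)) w"
  "feq (subst (twist i False) (subst (twist i True) w)) w"
  using subst_twist_twist[of i True] subst_twist_twist[of i False] by simp_all

text \<open>Evaluating a relator leaves a prefix of letters followed by twists applied to
  \<open>w\<close>. The \<open>feq_rev\<close> rules collect this prefix in an accumulator, where it
  reduces to the empty word; the twists cancel in pairs.\<close>

lemma free_act_relator:
  assumes "r \<in> relators"
  shows "feq (free_act r w) w"
proof -
  \<comment> \<open>The relator for the conjugates of \<open>a2\<close> contains four
    \<open>a2\<close>-letters, hence two nested cancellations.\<close>
  have 4: "feq (subst (twist 2 False) (subst (twist 2 True)
                 (subst (twist 2 True) (subst (twist 2 False) w)))) w"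
    by (meson feq_trans subst_feq subst_twist_cancel)
  show ?thesis
    using assms unfolding relators_def
    by (elim insertE emptyE; simp add: comm_def eqrel_def conj_def gen_def inv_word_def inv_letter_def
       twist_def[of _ _ "Suc 0"] twist_def[of _ _ "1"] twist_def[of _ _ "3"] twist_def[of _ _ "4"])
      (rule feq_rev_start, (rule feq_rev_step)+, rule feq_rev_end,
       simp add: inv_letter_def, simp add: subst_twist_cancel 4)+
qed

text \<open>The freeness of the normal subgroup enters here: equality in the group yields free
  equality of the images.\<close>

lemma free_act_eqw: "eqw u v \<Longrightarrow> feq (free_act u w) (free_act v w)"
proof (induction rule: eqw.induct)
  case (cancel u l v)
  show ?case
    using free_act_feq[OF free_act_cancel[of l "free_act v w"], of u]
    by (metis free_act_append)
next
  case (rel r u v)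
  show ?case
    using free_act_feq[OF free_act_relator[OF rel, of "free_act v w"], of u]
    by (simp add: free_act_append)
qed (blast intro: feq.intros)+

section \<open>Sums along paths in the Cayley graph\<close>

text \<open>The first entry of an argument list is a vertex of the Cayley graph, translated from the
  left; the other entries are parameters.\<close>

definition tr :: "word \<Rightarrow> word list \<Rightarrow> word list" where
  "tr w l = (w @ hd l) # tl l"

lemma tr_Cons [simp]: "tr w (z # ys) = (w @ z) # ys"
  by (simp add: tr_def)

lemma tr_tr [simp]: "tr u (tr v l) = tr (u @ v) l"
  by (simp add: tr_def)

lemma tr_Nil [simp]: "l \<noteq> [] \<Longrightarrow> tr [] l = l"
  by (simp add: tr_def)

lemma length_tr [simp]: "l \<noteq> [] \<Longrightarrow> length (tr w l) = length l"
  by (simp add: tr_def)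

lemma tr_neq_Nil [simp]: "tr w l \<noteq> []"
  by (simp add: tr_def)

definition resp :: "(word list \<Rightarrow> int) \<Rightarrow> bool" where
  "resp f \<longleftrightarrow> (\<forall>xs ys. list_all2 eqw xs ys \<longrightarrow> f xs = f ys)"

lemma respI: "(\<And>xs ys. list_all2 eqw xs ys \<Longrightarrow> f xs = f ys) \<Longrightarrow> resp f"
  by (simp add: resp_def)

lemma respD: "resp f \<Longrightarrow> list_all2 eqw xs ys \<Longrightarrow> f xs = f ys"
  by (simp add: resp_def)

lemma list_all2_eqw_refl: "list_all2 eqw xs xs"
  by (simp add: list_all2_refl eqw.refl)

lemma list_all2_eqw_tr: "eqw u v \<Longrightarrow> list_all2 eqw (tr u l) (tr v l)"
  by (simp add: tr_def eqw_append2 eqw.refl list_all2_eqw_refl)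

lemma list_all2_eqw_tr': "list_all2 eqw l l' \<Longrightarrow> list_all2 eqw (tr w l) (tr w l')"
  by (cases l; cases l') (auto simp: tr_def eqw_append2 eqw.refl)

lemma resp_tr: "resp f \<Longrightarrow> eqw u v \<Longrightarrow> f (tr u l) = f (tr v l)"
  by (rule respD[OF _ list_all2_eqw_tr])

lemma resp_compose_tr: "resp f \<Longrightarrow> resp (\<lambda>l. f (tr w l))"
  by (blast intro: respI respD list_all2_eqw_tr')

lemma resp_const: "resp (\<lambda>_. c)"
  by (simp add: resp_def)

lemma resp_add: "resp f \<Longrightarrow> resp g \<Longrightarrow> resp (\<lambda>l. f l + g l)"
  unfolding resp_def by metis

lemma resp_uminus: "resp f \<Longrightarrow> resp (\<lambda>l. - f l)"
  unfolding resp_def by metis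

lemma resp_diff: "resp f \<Longrightarrow> resp g \<Longrightarrow> resp (\<lambda>l. f l - g l)"
  unfolding resp_def by metis

lemma resp_Cons: "resp f \<Longrightarrow> resp (\<lambda>l. f (x # l))"
  by (simp add: resp_def eqw.refl)

text \<open>Signed sum of \<open>W\<close> along the path from \<open>z\<close> to \<open>w z\<close> in the Cayley graph, where \<open>l = z # ys\<close>. Words
  are read from the right, and \<open>W i (z # ys)\<close> belongs to the edge from \<open>z\<close> to \<open>gen i @ z\<close>.\<close>

fun psum :: "(nat \<Rightarrow> word list \<Rightarrow> int) \<Rightarrow> word \<Rightarrow> word list \<Rightarrow> int" where
  "psum W [] l = 0"
| "psum W (a # w) l =
     psum W w l + (if snd a then - W (fst a) (tr (a # w) l) else W (fst a) (tr w l))"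

lemma psum_append: "psum W (u @ v) l = psum W u (tr v l) + psum W v l"
  by (induction u) auto

lemma psum_resp: "(\<And>i. resp (W i)) \<Longrightarrow> resp (psum W w)"
proof (induction w)
  case (Cons a w)
  then show ?case
    by (cases "snd a") (auto intro!: resp_add resp_diff resp_compose_tr)
qed (simp add: resp_def)

lemma psum_cancel:
  assumes "\<And>i. resp (W i)"
  shows "psum W [a, inv_letter a] l = 0"
proof (cases a)
  case (Pair i s)
  have "W i (tr [a, inv_letter a] l) = W i (tr [] l)"
    by (rule resp_tr[OF assms]) (use eqw.cancel[of "[]" a "[]"] in simp)
  then show ?thesis by (cases s) (auto simp: Pair inv_letter_def)
qed

text \<open>Traversing an edge back and forth contributes nothing, so the sum depends only on the
  free class of the path.\<close>

lemma psum_feq: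
  assumes "\<And>i. resp (W i)"
  shows "feq u v \<Longrightarrow> psum W u l = psum W v l"
proof (induction arbitrary: l rule: feq.induct)
  case (feq_cancel u a v)
  have "psum W u (tr ([a, inv_letter a] @ v) l) = psum W u (tr v l)"
    by (rule resp_tr[OF psum_resp[OF assms]]) (use eqw.cancel[of "[]" a v] in simp)
  then show ?case using psum_cancel[where W = W and a = a and l = "tr v l", OF assms]
    by (metis add_0 psum_append)
qed auto

text \<open>A relator inserted into a path is a loop at some vertex, so vanishing loop sums at all
  base points make the sum depend only on the group element.\<close>

lemma psum_eqw:
  assumes "\<And>i. resp (W i)"
    and "\<And>r l. r \<in> relators \<Longrightarrow> length l = k \<Longrightarrow> psum W r l = 0" and "k > 0"
  shows "eqw u v \<Longrightarrow> length l = k \<Longrightarrow> psum W u l = psum W v l"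
proof (induction arbitrary: l rule: eqw.induct)
  case (cancel u a v)
  then show ?case by (intro psum_feq[OF assms(1)] feq_cancel)
next
  case (rel r u v)
  have "length (tr v l) = k" using rel assms(3) by (auto simp: tr_def)
  moreover have "psum W u (tr (r @ v) l) = psum W u (tr v l)"
    by (rule resp_tr[OF psum_resp[OF assms(1)]]) (use eqw.rel[OF rel(1), of "[]" v] in simp)
  ultimately show ?case using assms(2)[OF rel(1), of "tr v l"]
    by (metis add_0 psum_append)
qed auto

text \<open>The free subgroup acts freely on \<open>G\<^sub>3\<close> by left translation, so prescribed differences along
  its generators can be integrated.\<close>

lemma differences_integrable:
  assumes A: "\<And>i. resp (A i)"
  obtains f where "resp f"
    "\<And>i l. i \<in> {1, 3, 4} \<Longrightarrow> l \<noteq> [] \<Longrightarrow> f (tr (gen i) l) = f l + A i l"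
proof
  \<comment> \<open>\<open>p l\<close> is the component of the first entry in the free subgroup. The
    path labelled by it starts at a representative of the orbit of that entry and ends at the entry
    itself.\<close>
  define p where "p = (\<lambda>l. free_act (hd l) [])"
  define f where "f = (\<lambda>l. psum A (p l) (tr (inv_word (p l)) l))"
  show "resp f"
  proof (rule respI)
    fix l l' assume l: "list_all2 eqw l l'"
    then have "eqw (hd l) (hd l')" by (cases l; cases l') (auto intro: eqw.refl)
    then have p: "feq (p l) (p l')" unfolding p_def by (rule free_act_eqw)
    have "f l = psum A (p l') (tr (inv_word (p l)) l)"
      unfolding f_def by (rule psum_feq[OF A p])
    also have "\<dots> = psum A (p l') (tr (inv_word (p l')) l)"
      by (intro resp_tr psum_resp A feq_imp_eqw feq_inv_word p)
    also have "\<dots> = f l'"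
      unfolding f_def by (intro respD[OF psum_resp[OF A]] list_all2_eqw_tr' l)
    finally show "f l = f l'" .
  qed
  fix i l assume i: "i \<in> {1, 3, 4::nat}" and l: "l \<noteq> ([] :: word list)"
  let ?x = "(i, False)"
  have p: "p (tr (gen i) l) = [?x] @ p l"
    using i by (auto simp: p_def tr_def gen_def)
  \<comment> \<open>Translating by a generator prepends one letter to \<open>p l\<close>. The start
    of the new path carries a cancelling pair, so the new path is the old one followed by one more
    edge.\<close>
  let ?q = "inv_word (p l) @ [inv_letter ?x, ?x]"
  have q: "eqw ?q (inv_word (p l))"
    using eqw.cancel[of "inv_word (p l)" "inv_letter ?x" "[]"] by simp
  have "f (tr (gen i) l) = A i (tr (p l @ ?q) l) + psum A (p l) (tr ?q l)"
    unfolding f_def p by (simp add: inv_word_Cons gen_def)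
  also have "psum A (p l) (tr ?q l) = f l"
    unfolding f_def by (intro resp_tr psum_resp A q)
  also have "A i (tr (p l @ ?q) l) = A i (tr [] l)"
  proof (intro resp_tr A)
    have "eqw (p l @ ?q) (p l @ inv_word (p l))" by (intro eqw_append2 eqw.refl q)
    then show "eqw (p l @ ?q) []"
      using feq_imp_eqw[OF feq_right_inv[of "p l"]] by (rule eqw.trans)
  qed
  finally show "f (tr (gen i) l) = f l + A i l" using l by simp
qed

section \<open>Cocycles and loop sums\<close>

text \<open>The part of the coboundary of a cochain in which the first argument survives.\<close>

fun tdelta :: "(word list \<Rightarrow> int) \<Rightarrow> word list \<Rightarrow> int" where
  "tdelta F [] = 0"
| "tdelta F [x] = - F []"
| "tdelta F (x # y # zs) = - F ((x @ y) # zs) - tdelta (\<lambda>l. F (x # l)) (y # zs)"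

lemma merge_Suc: "i \<ge> 1 \<Longrightarrow> merge (Suc i) (x # l) = x # merge i l"
  by (cases i) (auto simp: merge_def)

text \<open>Once the face forgetting the first argument is split off, the remaining faces after the
  first merge are those of the slice at \<open>x\<close>; the index shift in \<open>merge\<close>
  supplies the sign.\<close>

lemma delta_eq_tdelta: "length xs = n \<Longrightarrow> delta n F (x # xs) = F xs + tdelta F (x # xs)"
proof (induction xs arbitrary: x F n)
  case Nil
  then show ?case by (simp add: delta_def)
next
  case (Cons y zs)
  then obtain m where n: "n = Suc m" "length zs = m" by auto
  let ?G = "\<lambda>l. F (x # l)"
  have "(\<Sum>i=1..Suc m. (-1) ^ i * F (merge i (x # y # zs))) =
      - F (merge 1 (x # y # zs)) + (\<Sum>i=1..m. (-1) ^ Suc i * F (merge (Suc i) (x # y # zs)))"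
    by (subst sum.atLeast_Suc_atMost) (auto simp: sum.shift_bounds_cl_Suc_ivl simp del: sum.cl_ivl_Suc)
  also have "(\<Sum>i=1..m. (-1) ^ Suc i * F (merge (Suc i) (x # y # zs))) =
      - (\<Sum>i=1..m. (-1) ^ i * ?G (merge i (y # zs)))"
    by (simp add: merge_Suc sum_negf[symmetric])
  finally have "delta n F (x # y # zs) =
      F (y # zs) - F ((x @ y) # zs) - (delta m ?G (y # zs) - ?G zs)"
    by (simp add: n delta_def merge_def)
  then show ?case using Cons.IH[OF n(2), of ?G y] by simp
qed

lemma tdelta_cong:
  "(\<And>l. length l = length xs - 1 \<Longrightarrow> F l = G l) \<Longrightarrow> tdelta F xs = tdelta G xs"
proof (induction xs arbitrary: F G rule: induct_list012)
  case (3 x y zs)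
  have "tdelta (\<lambda>l. F (x # l)) (y # zs) = tdelta (\<lambda>l. G (x # l)) (y # zs)"
    by (rule 3(2)) (simp add: 3(3))
  then show ?case using 3(3) by simp
qed auto

lemma tdelta_const_0 [simp]: "tdelta (\<lambda>_. 0) xs = 0"
  by (induction xs rule: induct_list012) auto

lemma tdelta_add: "tdelta (\<lambda>l. F l + G l) xs = tdelta F xs + tdelta G xs"
  by (induction xs arbitrary: F G rule: induct_list012) auto

lemma tdelta_uminus: "tdelta (\<lambda>l. - F l) xs = - tdelta F xs"
  by (induction xs arbitrary: F rule: induct_list012) auto

lemma tdelta_diff: "tdelta (\<lambda>l. F l - G l) xs = tdelta F xs - tdelta G xs"
  by (induction xs arbitrary: F G rule: induct_list012) auto

lemma tdelta_tdelta: "length xs \<ge> 2 \<Longrightarrow> tdelta (tdelta F) xs = 0"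
proof (induction xs arbitrary: F rule: induct_list012)
  case (3 x y zs)
  show ?case
  proof (cases zs)
    case (Cons w ws)
    let ?H = "\<lambda>l. F ((x @ hd l) # tl l)"
    have "tdelta (\<lambda>l. tdelta F (x # l)) (y # w # ws) =
        tdelta (\<lambda>l. - ?H l - tdelta (\<lambda>l. F (x # l)) l) (y # w # ws)"
    proof (rule tdelta_cong)
      fix l :: "word list" assume "length l = length (y # w # ws) - 1"
      then show "tdelta F (x # l) = - ?H l - tdelta (\<lambda>l. F (x # l)) l" by (cases l) auto
    qed
    also have "\<dots> = - tdelta ?H (y # w # ws) - tdelta (tdelta (\<lambda>l. F (x # l))) (y # w # ws)"
      by (simp only: tdelta_diff tdelta_uminus)
    also have "tdelta (tdelta (\<lambda>l. F (x # l))) (y # w # ws) = 0"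
      using "3.IH"(2) by (simp add: Cons)
    finally show ?thesis by (simp add: Cons)
  qed simp
qed auto

lemma tdelta_tr: "length xs \<ge> 2 \<Longrightarrow> tdelta (\<lambda>l. F (tr w l)) xs = tdelta F (tr w xs)"
  by (induction xs rule: induct_list012) auto

text \<open>Inserting the empty word in front is a contracting homotopy for
  \<open>tdelta\<close>.\<close>

lemma tdelta_contract:
  assumes "tdelta F ([] # l) = 0" "l \<noteq> []"
  shows "F l = tdelta (\<lambda>l. - F ([] # l)) l"
  using assms by (cases l) (auto simp: tdelta_uminus)

lemma tdelta_eqw: "list_all2 eqw xs ys \<Longrightarrow> resp F \<Longrightarrow> tdelta F xs = tdelta F ys"
proof (induction xs arbitrary: F ys rule: induct_list012)
  case (3 x y zs)
  note rF = \<open>resp F\<close>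
  obtain x' y' zs' where ys: "ys = x' # y' # zs'"
    and e: "eqw x x'" "eqw y y'" "list_all2 eqw zs zs'"
    using 3(3) by (auto simp: list_all2_Cons1)
  have 1: "F ((x @ y) # zs) = F ((x' @ y') # zs')"
    using e by (intro respD[OF rF]) (simp add: eqw_append2)
  have "tdelta (\<lambda>l. F (x # l)) (y # zs) = tdelta (\<lambda>l. F (x # l)) (y' # zs')"
    using e by (intro 3(2) resp_Cons rF) simp
  also have "\<dots> = tdelta (\<lambda>l. F (x' # l)) (y' # zs')"
    using e by (intro tdelta_cong respD[OF rF]) (simp add: list_all2_eqw_refl)
  finally show ?case using 1 by (simp add: ys)
qed (auto simp: list_all2_Cons1)

lemma tdelta_resp: "resp F \<Longrightarrow> resp (tdelta F)"
  by (blast intro: respI tdelta_eqw)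

lemma resp_tl: "resp F \<Longrightarrow> resp (\<lambda>l. F (tl l))"
  by (rule respI, erule respD) (metis list_all2_Nil list_all2_Nil2 list.rel_sel list.sel(2))

lemma tdelta_psum:
  "length xs \<ge> 2 \<Longrightarrow> tdelta (psum W w) xs = psum (\<lambda>i. tdelta (W i)) w xs"
proof (induction w)
  case Nil
  have "psum W [] = (\<lambda>_. 0)" by (rule ext) simp
  then show ?case by simp
next
  case (Cons a w)
  have *: "psum W (a # w) = (\<lambda>l. psum W w l + (if snd a then - W (fst a) (tr (a # w) l) else W (fst a) (tr w l)))"
    by (rule ext) simp
  show ?case unfolding *
    using Cons by (cases "snd a") (auto simp: tdelta_add tdelta_diff tdelta_tr)
qed

text \<open>Written with \<open>tdelta\<close> so that the face forgetting the first argument stands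
  alone, and over all words so that no validity has to be tracked.\<close>

definition tot_cocycle :: "nat \<Rightarrow> (word list \<Rightarrow> int) \<Rightarrow> bool" where
  "tot_cocycle n f \<longleftrightarrow> resp f \<and> (\<forall>xs. length xs = n + 1 \<longrightarrow> f (tl xs) + tdelta f xs = 0)"

definition tot_coboundary :: "nat \<Rightarrow> (word list \<Rightarrow> int) \<Rightarrow> bool" where
  "tot_coboundary n f \<longleftrightarrow> (\<exists>h. resp h \<and> (\<forall>xs. length xs = n \<longrightarrow> f xs = h (tl xs) + tdelta h xs))"

lemma tot_cocycleD: "tot_cocycle n f \<Longrightarrow> length l = n \<Longrightarrow> f l + tdelta f (x # l) = 0"
  unfolding tot_cocycle_def by (drule conjunct2, drule spec[of _ "x # l"]) simp

lemma tot_cocycle_resp: "tot_cocycle n f \<Longrightarrow> resp f"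
  by (simp add: tot_cocycle_def)

section \<open>Loop sums and integration of the edge function\<close>

definition loop_sum :: "(word list \<Rightarrow> int) \<Rightarrow> word \<Rightarrow> word list \<Rightarrow> int" where
  "loop_sum f = psum (\<lambda>i l. f (gen i # l))"

lemma tot_cocycle_slice:
  assumes "tot_cocycle n f" "length l = n" "n \<ge> 1"
  shows "tdelta (\<lambda>l. f (x # l)) l = f l - f (tr x l)"
proof (cases l)
  case (Cons z ys)
  have "f (z # ys) + tdelta f (x # z # ys) = 0"
    using assms(2) by (intro tot_cocycleD[OF assms(1)]) (simp add: Cons)
  then show ?thesis by (simp add: Cons)
qed (use assms in simp)

text \<open>By \<open>tot_cocycle_slice\<close> each edge contributes the difference of
  \<open>f\<close> at its end points, and these telescope along the path.\<close>

lemma tdelta_loop_sum: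
  assumes "tot_cocycle n f" "length l = n" "n \<ge> 2"
  shows "tdelta (loop_sum f w) l = f l - f (tr w l)"
proof -
  have l: "l \<noteq> []" "length l \<ge> 2" "n \<ge> 1" using assms by auto
  have "tdelta (loop_sum f w) l = psum (\<lambda>i. tdelta (\<lambda>l. f (gen i # l))) w l"
    unfolding loop_sum_def by (rule tdelta_psum) (use l in simp)
  also have "\<dots> = f l - f (tr w l)"
  proof (induction w)
    case (Cons a w)
    obtain i s where a: "a = (i, s)" by force
    have *: "tdelta (\<lambda>l. f (gen i # l)) (tr v l) = f (tr v l) - f (tr (gen i @ v) l)" for v
      using tot_cocycle_slice[OF assms(1) _ l(3), of "tr v l" "gen i"] l assms by simp
    have "f (tr (gen i @ (i, True) # w) l) = f (tr w l)"
      by (rule resp_tr[OF tot_cocycle_resp[OF assms(1)]])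
        (use eqw.cancel[of "[]" "(i, False)" w] in \<open>simp add: gen_def inv_letter_def\<close>)
    then show ?case using Cons *[of w] *[of "a # w"] by (auto simp: a gen_def)
  qed (use l in simp)
  finally show ?thesis .
qed

text \<open>Integrating the corrected edge function gives a cochain whose coboundary, subtracted
  from \<open>f\<close>, leaves a cocycle \<open>g\<close> closed in the remaining arguments for
  each fixed first one. Such a \<open>g\<close> is independent of its first argument and is the
  coboundary of its slice at the empty word.\<close>

lemma tot_coboundaryI:
  assumes f: "tot_cocycle n f" and n: "n \<ge> 2"
    and s: "\<And>i. resp (s i)" "\<And>i l. length l = n \<Longrightarrow> tdelta (s i) l = 0"
    and rel: "\<And>r l. r \<in> relators \<Longrightarrow> length l = n - 1 \<Longrightarrow> psum s r l = loop_sum f r l"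
  shows "tot_coboundary n f"
proof -
  have rf: "resp f" by (rule tot_cocycle_resp[OF f])
  define E where "E = (\<lambda>i l. s i l - f (gen i # l))"
  have E: "resp (E i)" for i
    unfolding E_def by (intro resp_diff s resp_Cons rf)
  have psum_E: "psum E w l = psum s w l - loop_sum f w l" for w l
    by (induction w) (auto simp: E_def loop_sum_def)
  define e where "e = (\<lambda>l. psum E (hd l) (tr [] ([] # tl l)))"
  have e_Cons: "e (z # ys) = psum E z ([] # ys)" for z ys
    by (simp add: e_def)
  \<comment> \<open>The loop sums are matched only on lists of length \<open>n - 1\<close>, so
    invariance under \<open>eqw\<close> is available only there; elsewhere the value 0 is
    used.\<close>
  define e' where "e' = (\<lambda>l. if length l = n - 1 then e l else 0)"
  have e': "resp e'"
  proof (rule respI)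
    fix l l' assume l: "list_all2 eqw l l'"
    show "e' l = e' l'"
    proof (cases "length l = n - 1")
      case True
      obtain z ys where 1: "l = z # ys" using True n by (cases l) auto
      obtain z' ys' where 2: "l' = z' # ys'" "eqw z z'" "list_all2 eqw ys ys'"
        using l 1 by (auto simp: list_all2_Cons1)
      have "psum E z ([] # ys) = psum E z' ([] # ys)"
        by (rule psum_eqw[where k = "n - 1", OF E]) (use rel True 1 2 n in \<open>auto simp: psum_E\<close>)
      also have "\<dots> = psum E z' ([] # ys')"
        using 2 by (intro respD[OF psum_resp[OF E]]) (auto intro: eqw.refl)
      finally have "e l = e l'" by (simp add: e_Cons 1 2)
      then show ?thesis using l by (auto simp: e'_def dest: list_all2_lengthD)
    qed (use l in \<open>auto simp: e'_def dest: list_all2_lengthD\<close>)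
  qed
  define g where "g = (\<lambda>l. f l - (e' (tl l) + tdelta e' l))"
  have g_slice: "g (x # l) = f (x # l) + psum E x l + tdelta (\<lambda>l. e' (x # l)) l"
    if len: "length l = n - 1" for x l
  proof -
    obtain z ys where l: "l = z # ys" using len n by (cases l) auto
    have "e' ((x @ z) # ys) = psum E x l + e' l"
      using len by (simp add: e'_def l e_Cons psum_append)
    then show ?thesis by (simp add: g_def l)
  qed
  \<comment> \<open>The slice of \<open>f\<close> and its loop sum have the same
    \<open>tdelta\<close>, and the corrections \<open>s\<close> are closed.\<close>
  have g_closed: "tdelta (\<lambda>l. g (x # l)) l = 0" if len: "length l = n" for x l
  proof -
    have "tdelta (\<lambda>l. g (x # l)) l =
        tdelta (\<lambda>l. f (x # l) + (psum s x l - loop_sum f x l) + tdelta (\<lambda>l. e' (x # l)) l) l"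
      by (rule tdelta_cong) (use len in \<open>auto simp: g_slice psum_E\<close>)
    also have "\<dots> = tdelta (\<lambda>l. f (x # l)) l + (tdelta (psum s x) l - tdelta (loop_sum f x) l)
        + tdelta (tdelta (\<lambda>l. e' (x # l))) l"
      by (simp only: tdelta_add tdelta_diff)
    also have "tdelta (tdelta (\<lambda>l. e' (x # l))) l = 0"
      by (rule tdelta_tdelta) (use len n in simp)
    also have "tdelta (psum s x) l = 0"
    proof -
      have "psum (\<lambda>i. tdelta (s i)) w l = 0" for w
        using s(2) len n by (induction w) (auto simp: tr_def)
      then show ?thesis using len n by (simp add: tdelta_psum)
    qed
    also have "tdelta (loop_sum f x) l = f l - f (tr x l)"
      by (rule tdelta_loop_sum[OF f len n])
    also have "tdelta (\<lambda>l. f (x # l)) l = f l - f (tr x l)"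
      by (rule tot_cocycle_slice[OF f len]) (use n in simp)
    finally show ?thesis by simp
  qed
  have g_cocycle: "g l + tdelta g (x # l) = 0" if len: "length l = n" for x l
  proof -
    have "f l + tdelta f (x # l) = 0"
      by (rule tot_cocycleD[OF f len])
    moreover have "tdelta (tdelta e') (x # l) = 0"
      by (rule tdelta_tdelta) (use len n in simp)
    moreover have "tdelta g (x # l) = tdelta f (x # l) - (tdelta (\<lambda>l. e' (tl l)) (x # l) + tdelta (tdelta e') (x # l))"
      unfolding g_def by (simp only: tdelta_diff tdelta_add)
    moreover have "tdelta (\<lambda>l. e' (tl l)) (x # l) = - e' (tl l) - tdelta e' l"
      using len n by (cases l) auto
    ultimately show ?thesis by (simp add: g_def)
  qed
  \<comment> \<open>This is the cocycle identity at \<open>z # [] # ys\<close>, in which the slice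
    at \<open>z\<close> drops out by \<open>g_closed\<close>.\<close>
  have g_first: "g (z # ys) = g ([] # ys)" if len: "length ys = n - 1" for z ys
  proof -
    have "g ([] # ys) + tdelta g (z # [] # ys) = 0" using g_cocycle[of "[] # ys" z] len n by simp
    moreover have "tdelta (\<lambda>l. g (z # l)) ([] # ys) = 0"
      by (rule g_closed) (use len n in simp)
    ultimately show ?thesis by simp
  qed
  \<comment> \<open>Since \<open>tdelta p\<close> vanishes, the coboundary of \<open>p\<close> is
    \<open>p (tl l)\<close>, which equals \<open>g l\<close>.\<close>
  define p where "p = (\<lambda>l. g ([] # l))"
  have p_closed: "tdelta p l = 0" if "length l = n" for l
    unfolding p_def by (rule g_closed[OF that])
  have "resp g" unfolding g_def
    by (intro resp_diff resp_add rf tdelta_resp resp_tl e')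
  then have "resp (\<lambda>l. e' l + p l)"
    unfolding p_def by (intro resp_add e' resp_Cons)
  moreover have "f l = e' (tl l) + p (tl l) + tdelta (\<lambda>l. e' l + p l) l" if len: "length l = n" for l
  proof -
    obtain z ys where l: "l = z # ys" using len n by (cases l) auto
    have "g l = p (tl l)" using g_first[of ys z] len by (simp add: l p_def)
    then have "f l = p (tl l) + (e' (tl l) + tdelta e' l)" by (simp add: g_def)
    then show ?thesis using p_closed[OF len] by (simp add: tdelta_add)
  qed
  ultimately show ?thesis unfolding tot_coboundary_def by (intro exI[of _ "\<lambda>l. e' l + p l"]) auto
qed

section \<open>Vanishing of the cohomology above degree two\<close>

lemma resp_tr_feq:
  "resp f \<Longrightarrow> foldr push u [] = foldr push v [] \<Longrightarrow> f (tr u l) = f (tr v l)"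
  by (intro resp_tr feq_imp_eqw feqI)

lemma resp_tr_relator:
  assumes "resp f" "r \<in> relators" "r = u @ v"
  shows "f (tr v l) = f (tr (inv_word u) l)"
proof -
  have "eqw (u @ v) []" using eqw.rel[OF assms(2), of "[]" "[]"] assms(3) by simp
  from eqw_solve_left[OF this, of "[]"] show ?thesis
    by (intro resp_tr assms(1)) simp
qed

lemma relator_words:
  "comm a1 b1 = [(0, True), (1, True), (0, False), (1, False)]"
  "comm a2 b2 = [(2, True), (3, True), (2, False), (3, False)]"
  "eqrel (conj b1 c1) (conj b1 a2) = [(4, True), (1, False), (4, False), (2, True), (1, True), (2, False)]"
  "eqrel (conj a1 c1) (conj a1 b2) = [(4, True), (0, False), (4, False), (3, True), (0, True), (3, False)]"
  "eqrel (conj b2 c1) (conj b2 (a1 @ b2)) = [(4, True), (3, False), (4, False), (3, True), (0, True), (3, True), (0, False), (3, False)]"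
  "eqrel (conj a2 c1) (conj a2 (b1 @ a2)) = [(4, True), (2, False), (4, False), (2, True), (1, True), (2, True), (1, False), (2, False)]"
  by (simp_all add: comm_def eqrel_def conj_def gen_def inv_word_def inv_letter_def)

lemmas relators_explicit = relators_def[unfolded relator_words]

text \<open>With weight zero on \<open>b1\<close>, \<open>b2\<close>, \<open>c1\<close>, each loop
  sum compares values of \<open>f\<close> at points of one orbit of the free subgroup, and so
  prescribes differences of \<open>f\<close>.\<close>

lemma solve_relators_a1:
  assumes T: "resp T1" "resp T2" "resp T3"
  obtains f where "resp f"
    "\<And>l W. l \<noteq> [] \<Longrightarrow> W 0 = f \<Longrightarrow> \<forall>i\<in>{1, 3, 4}. W i = (\<lambda>_. 0) \<Longrightarrow>
      psum W (comm a1 b1) l = T1 l \<and>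
      psum W (eqrel (conj a1 c1) (conj a1 b2)) l = T2 l \<and>
      psum W (eqrel (conj b2 c1) (conj b2 (a1 @ b2))) l = T3 l"
proof -
  \<comment> \<open>The first relator gives \<open>A 1\<close>. The second, based at b2^-1 a1 b2 y,
    says that \<open>A 4\<close> minus \<open>A 3\<close> is \<open>V\<close> at y. In the third,
    the start a1^-1 b2^-1 a1 b2 z of an \<open>a1\<close>-edge equals b2 c1^-1 b2^-1 c1 z in the
    group; eliminating \<open>A 4\<close> leaves the formula \<open>Ab\<close> for
    \<open>A 3\<close> at b2^-1 c1 z.\<close>
  define V where "V = (\<lambda>l. T2 (tr [(3, True), (0, False), (3, False)] l))"
  define Ab where "Ab = (\<lambda>l. T3 (tr [(4, True), (3, False)] l) + V (tr [(4, True), (3, False)] l)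
    - V (tr [(4, True)] l))"
  define A where "A = (\<lambda>i::nat. if i = 1 then T1 else if i = 3 then Ab else (\<lambda>l. Ab l + V l))"
  have V: "resp V" unfolding V_def by (intro resp_compose_tr T)
  have Ab: "resp Ab" unfolding Ab_def by (intro resp_add resp_diff resp_compose_tr T V)
  have A: "resp (A i)" for i unfolding A_def by (auto intro: resp_add T V Ab)
  obtain f where f: "resp f"
    and diff: "\<And>i l. i \<in> {1, 3, 4} \<Longrightarrow> l \<noteq> [] \<Longrightarrow> f (tr (gen i) l) = f l + A i l"
    by (rule differences_integrable[of A, OF A]) blast
  have d1: "f (tr [(1, False)] l) = f l + T1 l" if "l \<noteq> []" for l
    using diff[of 1 l] that by (simp add: A_def gen_def)
  have d3: "f (tr ((3, False) # w) l) = f (tr w l) + Ab (tr w l)" for w l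
    using diff[of 3 "tr w l"] by (simp add: A_def gen_def)
  have d4: "f (tr ((4, False) # w) l) = f (tr w l) + Ab (tr w l) + V (tr w l)" for w l
    using diff[of 4 "tr w l"] by (simp add: A_def gen_def)
  note red = resp_tr_feq[OF f] resp_tr_feq[OF Ab] resp_tr_feq[OF V] resp_tr_feq[OF T(2)] resp_tr_feq[OF T(3)]
  show thesis
  proof (rule that[OF f], intro conjI)
    fix l :: "word list" and W :: "nat \<Rightarrow> word list \<Rightarrow> int"
    assume l: "l \<noteq> []" and W: "W 0 = f" "\<forall>i\<in>{1, 3, 4}. W i = (\<lambda>_. 0)"
    have W': "W (Suc 0) = (\<lambda>_. 0)" "W 3 = (\<lambda>_. 0)" "W 4 = (\<lambda>_. 0)" using W(2) by auto
    have "f (tr [(0, True), (1, True), (0, False), (1, False)] l) = f l"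
      using resp_tr_relator[OF f, of "[(0, True), (1, True), (0, False), (1, False)]" "[]" _ l] l
      by (simp add: relators_explicit)
    then show "psum W (comm a1 b1) l = T1 l"
      using l d1[OF l] unfolding relator_words by (simp add: W W')
    show "psum W (eqrel (conj a1 c1) (conj a1 b2)) l = T2 l"
    proof -
      let ?w = "[(0, True), (3, False)]"
      have "f (tr ((4, False) # (3, True) # ?w) l) - f (tr ((3, False) # (3, True) # ?w) l)
          = V (tr ((3, True) # ?w) l)"
        by (simp only: d3 d4)
      moreover have "f (tr ((3, False) # (3, True) # ?w) l) = f (tr ?w l)"
        by (rule red) (simp add: inv_letter_def)
      moreover have "V (tr ((3, True) # ?w) l) = T2 (tr [] l)"
        unfolding V_def tr_tr by (rule red) (simp add: inv_letter_def)
      ultimately show ?thesis using l unfolding relator_words by (simp add: W W')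
    qed
    show "psum W (eqrel (conj b2 c1) (conj b2 (a1 @ b2))) l = T3 l"
    proof -
      have "f (tr [(0, True), (3, True), (0, False), (3, False)] l)
          = f (tr (inv_word [(4, True), (3, False), (4, False), (3, True)]) l)"
        by (rule resp_tr_relator[OF f]) (auto simp: relators_explicit)
      also have "\<dots> = f (tr ((3, False) # [(4, True), (3, True), (4, False)]) l)"
        by (rule red) (simp add: inv_word_def inv_letter_def)
      finally have 1: "f (tr [(0, True), (3, True), (0, False), (3, False)] l)
        = f (tr ((3, False) # [(4, True), (3, True), (4, False)]) l)" .
      have 2: "f (tr ((4, False) # [(4, True), (3, True), (4, False)]) l) = f (tr [(3, True), (4, False)] l)"
        "f (tr ((3, False) # [(3, True), (4, False)]) l) = f (tr [(4, False)] l)"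
        by (rule red; simp add: inv_letter_def)+
      have 3: "Ab (tr [(3, True), (4, False)] l) = T3 (tr [] l) + V (tr [] l) - V (tr [(4, True), (3, True), (4, False)] l)"
      proof -
        have "T3 (tr ([(4, True), (3, False)] @ [(3, True), (4, False)]) l) = T3 (tr [] l)"
          "V (tr ([(4, True), (3, False)] @ [(3, True), (4, False)]) l) = V (tr [] l)"
          by (rule red; simp add: inv_letter_def)+
        then show ?thesis by (simp add: Ab_def)
      qed
      show ?thesis
        using 1 2 3 d3[of "[(3, True), (4, False)]" l] d3[of "[(4, True), (3, True), (4, False)]" l]
          d3[of "[]" l] d4[of "[]" l] d4[of "[(4, True), (3, True), (4, False)]" l] l
        unfolding relator_words by (simp add: W W')
    qed
  qed
qed

lemma solve_relators_a2:
  assumes T: "resp T1" "resp T2" "resp T3"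
  obtains f where "resp f"
    "\<And>l W. l \<noteq> [] \<Longrightarrow> W 2 = f \<Longrightarrow> \<forall>i\<in>{1, 3, 4}. W i = (\<lambda>_. 0) \<Longrightarrow>
      psum W (comm a2 b2) l = T1 l \<and>
      psum W (eqrel (conj b1 c1) (conj b1 a2)) l = T2 l \<and>
      psum W (eqrel (conj a2 c1) (conj a2 (b1 @ a2))) l = T3 l"
proof -
  \<comment> \<open>The third equation, simplified by the second, gives the difference
    \<open>Ac\<close> along \<open>c1\<close> outright. The second relator replaces conjugation by
    \<open>a2\<close> with conjugation by \<open>c1\<close>, which then expresses the difference
    \<open>Ab\<close> along \<open>b1\<close> through \<open>Ac\<close>.\<close>
  define Ac where "Ac = (\<lambda>l. T3 (tr [(2, True), (1, True), (2, False), (1, False), (2, False)] l)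
    + T2 (tr [(1, False), (2, False)] l))"
  define Ab where "Ab = (\<lambda>l. Ac (tr [(4, True), (1, False)] l) - Ac (tr [(4, True)] l)
    + T2 (tr [(4, True), (1, False)] l))"
  define A where "A = (\<lambda>i::nat. if i = 3 then T1 else if i = 1 then Ab else Ac)"
  have Ac: "resp Ac" unfolding Ac_def by (intro resp_add resp_compose_tr T)
  have Ab: "resp Ab" unfolding Ab_def by (intro resp_add resp_diff resp_compose_tr T Ac)
  have A: "resp (A i)" for i unfolding A_def by (auto intro: T Ac Ab)
  obtain f where f: "resp f"
    and diff: "\<And>i l. i \<in> {1, 3, 4} \<Longrightarrow> l \<noteq> [] \<Longrightarrow> f (tr (gen i) l) = f l + A i l"
    by (rule differences_integrable[of A, OF A]) blast
  have d1: "f (tr ((1, False) # w) l) = f (tr w l) + Ab (tr w l)" for w l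
    using diff[of 1 "tr w l"] by (simp add: A_def gen_def)
  have d3: "f (tr [(3, False)] l) = f l + T1 l" if "l \<noteq> []" for l
    using diff[of 3 l] that by (simp add: A_def gen_def)
  have d4: "f (tr ((4, False) # w) l) = f (tr w l) + Ac (tr w l)" for w l
    using diff[of 4 "tr w l"] by (simp add: A_def gen_def)
  note red = resp_tr_feq[OF f] resp_tr_feq[OF Ac] resp_tr_feq[OF T(2)] resp_tr_feq[OF T(3)]
  \<comment> \<open>This equation serves twice: as the second loop sum and, at a translated point,
    inside the third.\<close>
  have R2: "f l - f (tr [(2, True), (1, True), (2, False)] l) = T2 l" if l: "l \<noteq> []" for l
  proof -
    let ?w = "[(1, True), (4, False)]"
    have 1: "f (tr [(2, True), (1, True), (2, False)] l) = f (tr ((4, True) # ?w) l)"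
      using resp_tr_relator[OF f, of _ "[(4, True), (1, False), (4, False)]"
          "[(2, True), (1, True), (2, False)]" l]
      by (simp add: relators_explicit inv_word_def inv_letter_def)
    have 2: "f (tr ((1, False) # ?w) l) = f (tr [(4, False)] l)"
      "f (tr ((4, False) # (4, True) # ?w) l) = f (tr ?w l)"
      by (rule red; simp add: inv_letter_def)+
    have 3: "Ab (tr ?w l) = Ac (tr [] l) - Ac (tr ((4, True) # ?w) l) + T2 (tr [] l)"
    proof -
      have "Ac (tr ([(4, True), (1, False)] @ ?w) l) = Ac (tr [] l)"
        "T2 (tr ([(4, True), (1, False)] @ ?w) l) = T2 (tr [] l)"
        by (rule red; simp add: inv_letter_def)+
      then show ?thesis by (simp add: Ab_def)
    qed
    show ?thesis
      using 1 2 3 d4[of "[]" l] d1[of ?w l] d4[of "(4, True) # ?w" l] l by simp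
  qed
  show thesis
  proof (rule that[OF f], intro conjI)
    fix l :: "word list" and W :: "nat \<Rightarrow> word list \<Rightarrow> int"
    assume l: "l \<noteq> []" and W: "W 2 = f" "\<forall>i\<in>{1, 3, 4}. W i = (\<lambda>_. 0)"
    have W': "W (Suc 0) = (\<lambda>_. 0)" "W 3 = (\<lambda>_. 0)" "W 4 = (\<lambda>_. 0)" using W(2) by auto
    have "f (tr [(2, True), (3, True), (2, False), (3, False)] l) = f l"
      using resp_tr_relator[OF f, of "[(2, True), (3, True), (2, False), (3, False)]" "[]" _ l] l
      by (simp add: relators_explicit)
    then show "psum W (comm a2 b2) l = T1 l"
      using l d3[OF l] unfolding relator_words by (simp add: W W')
    show "psum W (eqrel (conj b1 c1) (conj b1 a2)) l = T2 l"
      using R2[OF l] l unfolding relator_words by (simp add: W W')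
    show "psum W (eqrel (conj a2 c1) (conj a2 (b1 @ a2))) l = T3 l"
    proof -
      let ?w = "[(2, True), (1, True), (2, True), (1, False), (2, False)]"
      let ?v = "[(2, True), (1, False), (2, False)]"
      have "f (tr ([(2, True), (1, True), (2, False)] @ ?v) l) = f (tr [] l)"
        by (rule red) (simp add: inv_letter_def)
      then have 1: "f (tr ?v l) - f l = T2 (tr ?v l)"
        using R2[of "tr ?v l"] l by simp
      have 2: "Ac (tr ?w l) = T3 l + T2 (tr ?v l)"
      proof -
        have "T3 (tr ([(2, True), (1, True), (2, False), (1, False), (2, False)] @ ?w) l) = T3 (tr [] l)"
          "T2 (tr ([(1, False), (2, False)] @ ?w) l) = T2 (tr ?v l)"
          by (rule red; simp add: inv_letter_def)+
        then show ?thesis using l by (simp add: Ac_def)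
      qed
      show ?thesis using 1 2 d4[of ?w l] l unfolding relator_words by (simp add: W W')
    qed
  qed
qed

text \<open>The bound \<open>n \<ge> 3\<close> makes lists of length \<open>n - 1\<close> long
  enough for \<open>tdelta\<close> to pass through path sums, so edge functions with loop sums
  \<open>T r\<close> yield closed corrections \<open>tdelta (W i)\<close>.\<close>

lemma tot_coboundary_high:
  assumes f: "tot_cocycle n f" and n: "n \<ge> 3"
  shows "tot_coboundary n f"
proof -
  \<comment> \<open>\<open>T r\<close> is the contracting homotopy applied to the loop sum, which is
    closed because a relator translates trivially.\<close>
  define T where "T = (\<lambda>r l. - loop_sum f r ([] # l))"
  have rf: "resp f" by (rule tot_cocycle_resp[OF f])
  have loop: "resp (loop_sum f r)" for r
    unfolding loop_sum_def by (intro psum_resp resp_Cons rf)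
  have T: "resp (T r)" for r
    unfolding T_def by (intro resp_uminus resp_Cons loop)
  have T_loop: "tdelta (T r) l = loop_sum f r l" if r: "r \<in> relators" and l: "length l = n - 1" for r l
  proof -
    have "f (tr r ([] # l)) = f (tr [] ([] # l))"
      by (intro resp_tr[OF rf]) (use eqw.rel[OF r, of "[]" "[]"] in simp)
    then have "tdelta (loop_sum f r) ([] # l) = 0"
      using tdelta_loop_sum[OF f, of "[] # l" r] l n by simp
    then show ?thesis unfolding T_def by (intro tdelta_contract[symmetric]) (use l n in auto)
  qed
  obtain f1 where f1: "resp f1" "\<And>l W. l \<noteq> [] \<Longrightarrow> W 0 = f1 \<Longrightarrow> \<forall>i\<in>{1, 3, 4}. W i = (\<lambda>_. 0) \<Longrightarrow>
      psum W (comm a1 b1) l = T (comm a1 b1) l \<and>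
      psum W (eqrel (conj a1 c1) (conj a1 b2)) l = T (eqrel (conj a1 c1) (conj a1 b2)) l \<and>
      psum W (eqrel (conj b2 c1) (conj b2 (a1 @ b2))) l = T (eqrel (conj b2 c1) (conj b2 (a1 @ b2))) l"
    by (rule solve_relators_a1[OF T T T]) blast
  obtain f2 where f2: "resp f2" "\<And>l W. l \<noteq> [] \<Longrightarrow> W 2 = f2 \<Longrightarrow> \<forall>i\<in>{1, 3, 4}. W i = (\<lambda>_. 0) \<Longrightarrow>
      psum W (comm a2 b2) l = T (comm a2 b2) l \<and>
      psum W (eqrel (conj b1 c1) (conj b1 a2)) l = T (eqrel (conj b1 c1) (conj b1 a2)) l \<and>
      psum W (eqrel (conj a2 c1) (conj a2 (b1 @ a2))) l = T (eqrel (conj a2 c1) (conj a2 (b1 @ a2))) l"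
    by (rule solve_relators_a2[OF T T T]) blast
  \<comment> \<open>Each relator involves only one of \<open>a1\<close> and \<open>a2\<close>, so
    the two problems are independent.\<close>
  define W where "W = (\<lambda>i::nat. if i = 0 then f1 else if i = 2 then f2 else (\<lambda>_. 0))"
  have W_T: "psum W r l = T r l" if "r \<in> relators" "l \<noteq> []" for r l
  proof -
    have "W 0 = f1" "W 2 = f2" "\<forall>i\<in>{1, 3, 4}. W i = (\<lambda>_. 0)" by (auto simp: W_def)
    then show ?thesis
      using that(1) f1(2)[OF that(2), of W] f2(2)[OF that(2), of W] unfolding relators_def by blast
  qed
  have W: "resp (W i)" for i using f1(1) f2(1) by (simp add: W_def resp_const)
  show ?thesis
  proof (rule tot_coboundaryI[OF f])
    show "resp (tdelta (W i))" for i by (intro tdelta_resp W)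
    show "tdelta (tdelta (W i)) l = 0" if "length l = n" for i l
      using that n by (intro tdelta_tdelta) simp
    fix r l assume r: "r \<in> relators" and l: "length (l :: word list) = n - 1"
    have "psum (\<lambda>i. tdelta (W i)) r l = tdelta (psum W r) l"
      using l n by (intro tdelta_psum[symmetric]) simp
    also have "\<dots> = tdelta (T r) l"
      by (intro tdelta_cong W_T r) (use l n in auto)
    finally show "psum (\<lambda>i. tdelta (W i)) r l = loop_sum f r l" using T_loop[OF r l] by simp
  qed (use n in simp)
qed

section \<open>The ideal of relations in the exterior algebra\<close>

lemma shuffle_sign_square [simp]: "shuffle_sign S R * shuffle_sign S R = 1"
  by (simp add: shuffle_sign_def flip: power_mult_distrib)

lemma shuffle_sign_square_left [simp]: "shuffle_sign S R * (shuffle_sign S R * x) = x"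
  by (simp flip: mult.assoc)

lemma shuffle_sign_empty [simp]: "shuffle_sign {} R = 1" "shuffle_sign S {} = 1"
  by (simp_all add: shuffle_sign_def)

text \<open>The double product can be evaluated by simplification on explicit sets.\<close>

lemma shuffle_sign_prod:
  assumes "finite S" "finite R"
  shows "shuffle_sign S R = (\<Prod>s\<in>S. \<Prod>r\<in>R. if r < s then -1 else 1)"
proof -
  have "{(s, r). s \<in> S \<and> r \<in> R \<and> r < s} = (SIGMA s:S. {r \<in> R. r < s})" by auto
  then have "card {(s, r). s \<in> S \<and> r \<in> R \<and> r < s} = (\<Sum>s\<in>S. card {r \<in> R. r < s})"
    using assms by (simp add: card_SigmaI)
  moreover have "(\<Prod>r\<in>R. if r < s then -1 else 1 :: int) = (-1) ^ card {r \<in> R. r < s}" for s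
    using assms(2) by (subst prod.inter_filter[symmetric]) auto
  ultimately show ?thesis by (simp add: shuffle_sign_def power_sum)
qed

definition mon :: "nat set \<Rightarrow> int \<Rightarrow> ext" where
  "mon R k S = (if S = R then k else 0)"

lemma xgen_mon: "xgen i = mon {i} 1"
  by (rule ext) (simp add: xgen_def mon_def)

lemma wedge_infinite: "infinite T \<Longrightarrow> wedge u v T = 0"
  by (simp add: wedge_def)

lemma wedge_add_right: "wedge u (ext_add v w) T = wedge u v T + wedge u w T"
  by (simp add: wedge_def ext_add_def algebra_simps sum.distrib)

lemma wedge_mon:
  assumes "finite T"
  shows "wedge u (mon R k) T = (if R \<subseteq> T then shuffle_sign (T - R) R * u (T - R) * k else 0)"
proof -
  have *: "T - S = R \<longleftrightarrow> R \<subseteq> T \<and> S = T - R" if "S \<in> Pow T" for S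
    using that by auto
  have "wedge u (mon R k) T = (\<Sum>S\<in>Pow T. if T - S = R then shuffle_sign S R * u S * k else 0)"
    unfolding wedge_def mon_def by (rule sum.cong) auto
  also have "\<dots> = (\<Sum>S\<in>Pow T. if S = T - R then (if R \<subseteq> T then shuffle_sign S R * u S * k else 0) else 0)"
    by (rule sum.cong) (use * in auto)
  also have "\<dots> = (if R \<subseteq> T then shuffle_sign (T - R) R * u (T - R) * k else 0)"
    using assms by (simp add: sum.delta)
  finally show ?thesis .
qed

lemma wedge_mon_empty_left: "finite T \<Longrightarrow> wedge (mon {} k) v T = k * v T"
proof -
  assume "finite T"
  have "wedge (mon {} k) v T = (\<Sum>S\<in>Pow T. if S = {} then k * v T else 0)"
    unfolding wedge_def by (rule sum.cong) (auto simp: mon_def)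
  with \<open>finite T\<close> show ?thesis by simp
qed

lemma wedge_xgen:
  assumes "i \<noteq> j"
  shows "wedge (xgen i) (xgen j) = mon {i, j} (if i < j then 1 else -1)"
proof
  fix T
  show "wedge (xgen i) (xgen j) T = mon {i, j} (if i < j then 1 else -1) T"
  proof (cases "finite T")
    case True
    have "shuffle_sign {i} {j} = (if i < j then 1 else -1)"
      using assms by (simp add: shuffle_sign_prod)
    moreover have "{j} \<subseteq> T \<and> T - {j} = {i} \<longleftrightarrow> T = {i, j}"
      using assms by auto
    moreover have "wedge (xgen i) (xgen j) T =
        (if {j} \<subseteq> T \<and> T - {j} = {i} then shuffle_sign {i} {j} else 0)"
      using True by (auto simp: xgen_mon wedge_mon mon_def[of "{i}"])
    ultimately show ?thesis by (simp add: mon_def)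
  qed (auto simp: wedge_infinite mon_def)
qed

lemma rel_mon:
  "rel1 = ext_add (ext_add (mon {0, 4} 1) (mon {0, 3} 1)) (mon {3, 4} (-1))"
  "rel2 = ext_add (ext_add (mon {1, 4} 1) (mon {1, 2} 1)) (mon {2, 4} (-1))"
  "rel3 = mon {0, 2} 1" "rel4 = mon {1, 3} 1"
  by (simp_all add: rel1_def rel2_def rel3_def rel4_def wedge_xgen insert_commute)

lemma ext_deg_add: "ext_deg n u \<Longrightarrow> ext_deg n v \<Longrightarrow> ext_deg n (ext_add u v)"
  unfolding ext_deg_def ext_add_def by (metis add.right_neutral)

lemma ext_deg_mon: "S \<subseteq> {0..<5} \<Longrightarrow> card S = n \<Longrightarrow> ext_deg n (mon S k)"
  by (simp add: ext_deg_def mon_def)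

lemma ext_deg_rel: "ext_deg 2 rel1" "ext_deg 2 rel2"
  by (auto simp: rel_mon intro!: ext_deg_add ext_deg_mon)

lemma ext_deg_wedge:
  assumes "ext_deg p u" "ext_deg q v"
  shows "ext_deg (p + q) (wedge u v)"
  unfolding ext_deg_def
proof (intro allI impI)
  fix T assume T: "wedge u v T \<noteq> 0"
  then have fin: "finite T" using wedge_infinite by blast
  from T obtain S where S: "S \<subseteq> T" "u S \<noteq> 0" "v (T - S) \<noteq> 0"
    unfolding wedge_def by (elim sum.not_neutral_contains_not_neutral) auto
  then have "S \<subseteq> {0..<5}" "card S = p" "T - S \<subseteq> {0..<5}" "card (T - S) = q"
    using assms by (auto simp: ext_deg_def)
  moreover have "card T = card S + card (T - S)"
    using S(1) fin by (metis card_Diff_subset card_mono finite_subset le_add_diff_inverse)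
  ultimately show "T \<subseteq> {0..<5} \<and> card T = p + q" by blast
qed

text \<open>\<open>rel3\<close> and \<open>rel4\<close> are monomials, so the multipliers arise by
  dividing each term, up to sign, by one of them.\<close>

lemma monomial_ideal:
  assumes v: "ext_deg n v" "n \<ge> 2"
    and supp: "\<And>T. v T \<noteq> 0 \<Longrightarrow> {0, 2} \<subseteq> T \<or> {1, 3} \<subseteq> T"
  obtains u3 u4 where "ext_deg (n - 2) u3" "ext_deg (n - 2) u4"
    "v = ext_add (wedge u3 rel3) (wedge u4 rel4)"
proof
  define u3 where "u3 = (\<lambda>S. if S \<inter> {0, 2} = {} then shuffle_sign S {0, 2} * v (S \<union> {0, 2}) else 0)"
  \<comment> \<open>Terms divisible by both monomials are left to \<open>u3\<close>, so that they
    are not counted twice.\<close>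
  define u4 where "u4 = (\<lambda>S. if S \<inter> {1, 3} = {} \<and> \<not> {0, 2} \<subseteq> S then shuffle_sign S {1, 3} * v (S \<union> {1, 3}) else 0)"
  have deg: "S \<subseteq> {0..<5} \<and> card S = n - 2"
    if "v (S \<union> R) \<noteq> 0" "S \<inter> R = {}" "card R = 2" for S R
  proof -
    have "S \<union> R \<subseteq> {0..<5}" "card (S \<union> R) = n" using that v by (auto simp: ext_deg_def)
    moreover from this have "finite S" "finite R"
      using finite_subset by (metis finite_Un finite_atLeastLessThan)+
    ultimately show ?thesis using that by (auto simp: card_Un_disjoint)
  qed
  show "ext_deg (n - 2) u3" unfolding ext_deg_def u3_def
    using deg[of _ "{0, 2}"] by (auto split: if_splits)
  show "ext_deg (n - 2) u4" unfolding ext_deg_def u4_def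
    using deg[of _ "{1, 3}"] by (auto split: if_splits)
  show "v = ext_add (wedge u3 rel3) (wedge u4 rel4)"
  proof
    fix T
    show "v T = ext_add (wedge u3 rel3) (wedge u4 rel4) T"
    proof (cases "finite T")
      case True
      have *: "T - R \<union> R = T" "(T - R) \<inter> R = {}" if "R \<subseteq> T" for R using that by auto
      have "wedge u3 rel3 T = (if {0, 2} \<subseteq> T then v T else 0)"
        using *[of "{0, 2}"] True by (simp only: rel_mon wedge_mon u3_def) simp
      moreover have "{0, 2} \<subseteq> T - {1, 3} \<longleftrightarrow> {0, 2} \<subseteq> T" by auto
      then have "wedge u4 rel4 T = (if {1, 3} \<subseteq> T \<and> \<not> {0, 2} \<subseteq> T then v T else 0)"
        using *[of "{1, 3}"] True by (simp only: rel_mon wedge_mon u4_def) simp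
      ultimately show ?thesis using supp[of T] by (auto simp: ext_add_def)
    next
      case False
      then have "v T = 0" using v by (auto simp: ext_deg_def dest: finite_subset)
      with False show ?thesis by (simp add: ext_add_def wedge_infinite)
    qed
  qed
qed

text \<open>Modulo \<open>rel3\<close> and \<open>rel4\<close> only the coefficients at sets
  containing neither pair matter.\<close>

lemma ideal_degI:
  assumes "ext_deg n u" "n \<ge> 2" "ext_deg (n - 2) u1" "ext_deg (n - 2) u2"
    and "\<And>T. T \<subseteq> {0..<5} \<Longrightarrow> card T = n \<Longrightarrow> \<not> {0, 2} \<subseteq> T \<Longrightarrow> \<not> {1, 3} \<subseteq> T \<Longrightarrow>
      u T = wedge u1 rel1 T + wedge u2 rel2 T"
  shows "ideal_deg n u"
proof -
  define w where "w = ext_add (wedge u1 rel1) (wedge u2 rel2)"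
  have w: "ext_deg n w"
    using ext_deg_wedge[OF assms(3) ext_deg_rel(1)] ext_deg_wedge[OF assms(4) ext_deg_rel(2)] assms(2)
    unfolding w_def le_add_diff_inverse2[OF assms(2)] by (simp add: ext_deg_add)
  define v where "v = (\<lambda>S. u S - w S)"
  have v: "ext_deg n v" using assms(1) w unfolding ext_deg_def v_def by (metis diff_0_right diff_self)
  have "{0, 2} \<subseteq> T \<or> {1, 3} \<subseteq> T" if "v T \<noteq> 0" for T
  proof -
    have "T \<subseteq> {0..<5}" "card T = n" using v that by (auto simp: ext_deg_def)
    then show ?thesis using assms(5)[of T] that by (auto simp: v_def w_def ext_add_def)
  qed
  from monomial_ideal[OF v assms(2) this] obtain u3 u4
    where u34: "ext_deg (n - 2) u3" "ext_deg (n - 2) u4" "v = ext_add (wedge u3 rel3) (wedge u4 rel4)"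
    by blast
  have "u = ext_add w v" by (rule ext) (simp add: ext_add_def v_def)
  then show ?thesis
    unfolding ideal_deg_def using assms(2-4) u34 w_def by auto
qed

section \<open>The ideal in degree two and in higher degrees\<close>

lemma atLeastLessThan_5: "{0..<5} = {0, 1, 2, 3, 4::nat}"
  by auto

lemma card_2_subsets:
  "{S. S \<subseteq> {0..<5} \<and> card S = 2} =
    {{0, 1}, {0, 2}, {0, 3}, {0, 4}, {1, 2}, {1, 3}, {1, 4}, {2, 3}, {2, 4}, {3, 4::nat}}"
    (is "?A = ?B")
proof
  show "?A \<subseteq> ?B"
  proof
    fix S assume "S \<in> ?A"
    then obtain i j where S: "S = {i, j}" "i \<noteq> j" "i \<in> {0, 1, 2, 3, 4}" "j \<in> {0, 1, 2, 3, 4}"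
      by (auto simp: card_2_iff atLeastLessThan_5)
    show "S \<in> ?B"
      using S(3,4,2) unfolding S(1) by (elim insertE emptyE) (simp_all add: doubleton_eq_iff)
  qed
qed auto

text \<open>The six equations express the vanishing of the six values in
  \<open>loop_sum_phi_2\<close>. The multipliers of \<open>rel1\<close> and \<open>rel2\<close> are
  read off at {0, 3} and {1, 2}.\<close>

lemma ideal_deg_2:
  assumes u: "ext_deg 2 u"
  shows "ideal_deg 2 u \<longleftrightarrow> u {0, 1} = 0 \<and> u {2, 3} = 0 \<and> u {0, 4} = u {0, 3} \<and> u {3, 4} = - u {0, 3}
    \<and> u {1, 4} = u {1, 2} \<and> u {2, 4} = - u {1, 2}" (is "_ \<longleftrightarrow> ?R")
proof
  assume "ideal_deg 2 u"
  then obtain u1 u2 u3 u4 where "u = ext_add (ext_add (wedge u1 rel1) (wedge u2 rel2))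
                    (ext_add (wedge u3 rel3) (wedge u4 rel4))"
    by (auto simp: ideal_deg_def)
  then show ?R by (simp add: ext_add_def rel_mon wedge_add_right wedge_mon)
next
  assume R: ?R
  show "ideal_deg 2 u"
  proof (rule ideal_degI[OF u])
    show "ext_deg (2 - 2) (mon {} (u {0, 3}))" "ext_deg (2 - 2) (mon {} (u {1, 2}))"
      by (auto intro: ext_deg_mon)
    fix T :: "nat set"
    assume T: "T \<subseteq> {0..<5}" "card T = 2" and supp: "\<not> {0, 2} \<subseteq> T" "\<not> {1, 3} \<subseteq> T"
    have "T \<in> {S. S \<subseteq> {0..<5} \<and> card S = 2}" using T by simp
    then show "u T = wedge (mon {} (u {0, 3})) rel1 T + wedge (mon {} (u {1, 2})) rel2 T"
      using R supp unfolding card_2_subsets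
      by (elim insertE emptyE)
        (simp_all add: wedge_mon_empty_left rel_mon ext_add_def mon_def doubleton_eq_iff)
  qed simp
qed

text \<open>Such a set omits one of 0, 2 and one of 1, 3, and is therefore the complement of these
  two.\<close>

lemma card_3_subset_cases:
  assumes "T \<subseteq> {0..<5}" "card T \<ge> 3" "\<not> {0, 2} \<subseteq> T" "\<not> {1, 3} \<subseteq> T"
  shows "T \<in> {{0, 1, 4}, {0, 3, 4}, {1, 2, 4}, {2, 3, 4::nat}}"
proof -
  obtain i j where ij: "i \<in> {0, 2}" "j \<in> {1, 3}" "i \<notin> T" "j \<notin> T" using assms by auto
  then have "T \<subseteq> {0, 1, 2, 3, 4} - {i, j}" using assms(1) by (auto simp: atLeastLessThan_5)
  moreover have "card ({0, 1, 2, 3, 4} - {i, j}) = 3" using ij by auto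
  ultimately have "T = {0, 1, 2, 3, 4} - {i, j}"
    using assms(2) by (intro card_seteq) auto
  moreover have "(i = 0 \<or> i = 2) \<and> (j = 1 \<or> j = 3)" using ij by auto
  ultimately show ?thesis by (elim conjE disjE) (simp_all add: insert_Diff_if)
qed

lemma ideal_deg_high:
  assumes u: "ext_deg n u" and n: "n \<ge> 3"
  shows "ideal_deg n u"
proof (cases "n = 3")
  case True
  \<comment> \<open>Modulo the monomial relations, the generators 0, 1, 2 times \<open>rel1\<close>
    give minus the monomials {0, 3, 4}, {0, 1, 4}, {2, 3, 4}, and generator 1 times
    \<open>rel2\<close> gives minus {1, 2, 4}.\<close>
  define u1 :: ext where "u1 = (\<lambda>S. if S = {0} then - u {0, 3, 4} else if S = {1} then - u {0, 1, 4}
    else if S = {2} then - u {2, 3, 4} else 0)"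
  define u2 :: ext where "u2 = (\<lambda>S. if S = {1} then - u {1, 2, 4} else 0)"
  show ?thesis
  proof (rule ideal_degI[OF u])
    show "ext_deg (n - 2) u1" "ext_deg (n - 2) u2" by (auto simp: ext_deg_def u1_def u2_def True)
    fix T :: "nat set" assume "T \<subseteq> {0..<5}" "card T = n" "\<not> {0, 2} \<subseteq> T" "\<not> {1, 3} \<subseteq> T"
    then have "T \<in> {{0, 1, 4}, {0, 3, 4}, {1, 2, 4}, {2, 3, 4}}"
      using n by (intro card_3_subset_cases) auto
    then show "u T = wedge u1 rel1 T + wedge u2 rel2 T"
      by (elim insertE emptyE; simp add: rel_mon wedge_add_right wedge_mon u1_def u2_def
          insert_Diff_if shuffle_sign_prod)
  qed (use n in simp)
next
  case False
  \<comment> \<open>From degree 4 on, every monomial is divisible by that of \<open>rel3\<close> or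
    \<open>rel4\<close>, so zero multipliers suffice.\<close>
  have z: "ext_deg (n - 2) (\<lambda>_. 0)" by (simp add: ext_deg_def)
  show ?thesis
  proof (rule ideal_degI[OF u _ z z])
    fix T :: "nat set" assume T: "T \<subseteq> {0..<5}" "card T = n" "\<not> {0, 2} \<subseteq> T" "\<not> {1, 3} \<subseteq> T"
    then have "T \<in> {{0, 1, 4}, {0, 3, 4}, {1, 2, 4}, {2, 3, 4}}"
      using n by (intro card_3_subset_cases) auto
    then have "card T = 3" by auto
    then show "u T = wedge (\<lambda>_. 0) rel1 T + wedge (\<lambda>_. 0) rel2 T" using T False by simp
  qed (use n in simp)
qed

section \<open>Abelianization\<close>

lemma expsum_Nil [simp]: "expsum i [] = 0"
  by (simp add: expsum_def)

lemma expsum_Cons: "expsum i (l # w) = (if fst l = i then (if snd l then -1 else 1) else 0) + expsum i w"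
  by (simp add: expsum_def)

lemma expsum_append [simp]: "expsum i (u @ v) = expsum i u + expsum i v"
  by (simp add: expsum_def)

lemma expsum_inv_word [simp]: "expsum i (inv_word w) = - expsum i w"
  by (induction w) (auto simp: inv_word_Cons expsum_Cons inv_letter_def)

lemma expsum_relator: "r \<in> relators \<Longrightarrow> expsum i r = 0"
  by (auto simp: relators_def comm_def eqrel_def conj_def)

lemma expsum_cancel: "expsum i [l, inv_letter l] = 0"
  by (simp add: expsum_Cons inv_letter_def)

lemma expsum_eqw: "eqw u v \<Longrightarrow> expsum i u = expsum i v"
proof (induction rule: eqw.induct)
  case (cancel u l v)
  then show ?case using expsum_cancel[of i l] by (simp add: expsum_Cons)
qed (simp_all add: expsum_relator)

lemma expsum_eqab: "eqab u v \<Longrightarrow> expsum i u = expsum i v"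
proof (induction rule: eqab.induct)
  case (cancel u l v)
  then show ?case using expsum_cancel[of i l] by (simp add: expsum_Cons)
qed (simp_all add: expsum_relator expsum_Cons)

lemma eqab_append: "eqab u u' \<Longrightarrow> eqab (p @ u @ q) (p @ u' @ q)"
proof (induction rule: eqab.induct)
  case (cancel u l v)
  show ?case using eqab.cancel[of "p @ u" l "v @ q"] by simp
next
  case (rel r u v)
  then show ?case using eqab.rel[of r "p @ u" "v @ q"] by simp
next
  case (swap u l l' v)
  show ?case using eqab.swap[of "p @ u" l l' "v @ q"] by simp
qed (blast intro: eqab.intros)+

lemma eqab_move: "eqab (l # u @ v) (u @ l # v)"
proof (induction u)
  case (Cons m u)
  have "eqab (l # m # u @ v) (m # l # u @ v)" using eqab.swap[of "[]" l m "u @ v"] by simp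
  also have "eqab \<dots> (m # u @ l # v)" using eqab_append[OF Cons, of "[m]" "[]"] by simp
  finally (eqab.trans) show ?case by simp
qed (simp add: eqab.refl)

text \<open>Vanishing exponent sums force the inverse of the first letter to occur later; commuting
  the two together and cancelling shortens the word.\<close>

lemma eqab_Nil: "(\<And>i. i < 5 \<Longrightarrow> expsum i w = 0) \<Longrightarrow> valid w \<Longrightarrow> eqab w []"
proof (induction w rule: length_induct)
  case (1 w)
  show ?case
  proof (cases w)
    case (Cons l w')
    obtain i s where l: "l = (i, s)" by force
    have i: "i < 5" using 1(3) by (simp add: Cons l valid_def)
    have "expsum i w' = (if s then 1 else -1)"
      using 1(2)[OF i] by (auto simp: Cons l expsum_Cons)
    moreover have "if s then expsum i v \<le> 0 else expsum i v \<ge> 0" if "(i, \<not> s) \<notin> set v" for v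
      using that by (induction v) (auto simp: expsum_Cons split: if_splits)
    from this[of w'] have "(i, \<not> s) \<in> set w' \<or> (if s then expsum i w' \<le> 0 else expsum i w' \<ge> 0)"
      by blast
    ultimately have "inv_letter l \<in> set w'" by (auto simp: l inv_letter_def split: if_splits)
    then obtain u v where w': "w' = u @ inv_letter l # v" by (auto dest: split_list)
    have "eqab (u @ v) []"
    proof (rule 1(1)[rule_format])
      show "length (u @ v) < length w" by (simp add: Cons w')
      show "valid (u @ v)" using 1(3) by (auto simp: valid_def Cons w')
      show "expsum j (u @ v) = 0" if "j < 5" for j
        using 1(2)[OF that] expsum_cancel[of j l] by (simp add: Cons w' expsum_Cons)
    qed
    moreover have "eqab w (u @ l # inv_letter l # v)" unfolding Cons w' by (rule eqab_move)
    moreover have "eqab (u @ l # inv_letter l # v) (u @ v)" using eqab.cancel[of u l v] by simp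
    ultimately show ?thesis by (blast intro: eqab.trans)
  qed (simp add: eqab.refl)
qed

lemma feq_imp_eqab: "feq u v \<Longrightarrow> eqab u v"
  by (induction rule: feq.induct) (blast intro: eqab.intros)+

lemma valid_append [simp]: "valid (u @ v) \<longleftrightarrow> valid u \<and> valid v"
  by (auto simp: valid_def)

lemma valid_inv_word [simp]: "valid (inv_word w) \<longleftrightarrow> valid w"
  by (auto simp: valid_def inv_word_def inv_letter_def)

lemma eqab_iff_expsum:
  assumes "valid w" "valid v"
  shows "eqab w v \<longleftrightarrow> (\<forall>i<5. expsum i w = expsum i v)"
proof
  assume *: "\<forall>i<5. expsum i w = expsum i v"
  have "eqab (w @ inv_word v @ v) w"
    using eqab_append[OF feq_imp_eqab[OF feq_left_inv[of v]], of w "[]"] by simp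
  moreover have "eqab (w @ inv_word v) []" by (rule eqab_Nil) (use * assms in auto)
  from eqab_append[OF this, of "[]" v] have "eqab (w @ inv_word v @ v) v" by simp
  ultimately show "eqab w v" by (blast intro: eqab.intros)
qed (auto dest: expsum_eqab)

section \<open>Comparison of cochains on valid words and on all words\<close>

text \<open>Deleting the letters outside the five generators extends a cochain on valid words to one that
  respects \<open>eqw\<close> on all words.\<close>

definition clean :: "word \<Rightarrow> word" where
  "clean w = filter (\<lambda>l. fst l < 5) w"

lemma clean_append [simp]: "clean (u @ v) = clean u @ clean v"
  by (simp add: clean_def)

lemma valid_clean [simp]: "valid (clean w)"
  by (simp add: clean_def valid_def)

lemma clean_valid: "valid w \<Longrightarrow> clean w = w"
  by (simp add: clean_def valid_def filter_id_conv)

lemma map_clean_valid: "valid_list xs \<Longrightarrow> map clean xs = xs"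
  by (simp add: valid_list_def clean_valid map_idI)

lemma valid_list_map_clean [simp]: "valid_list (map clean xs)"
  by (simp add: valid_list_def)

lemma relators_valid: "r \<in> relators \<Longrightarrow> valid r"
  by (auto simp: relators_def comm_def eqrel_def conj_def gen_def valid_def inv_word_def inv_letter_def)

lemma eqw_clean: "eqw u v \<Longrightarrow> eqw (clean u) (clean v)"
proof (induction rule: eqw.induct)
  case (cancel u l v)
  have "clean [l, inv_letter l] = [] \<or> clean [l, inv_letter l] = [l, inv_letter l]"
    by (auto simp: clean_def inv_letter_def)
  moreover have "clean (u @ [l, inv_letter l] @ v) = clean u @ clean [l, inv_letter l] @ clean v"
    by (simp only: clean_append)
  ultimately show ?case
    using eqw.cancel[of "clean u" l "clean v"] by (auto intro: eqw.refl)
next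
  case (rel r u v)
  then show ?case by (simp add: clean_valid relators_valid eqw.rel)
qed (blast intro: eqw.intros)+

lemma expsum_clean: "i < 5 \<Longrightarrow> expsum i (clean w) = expsum i w"
  by (induction w) (auto simp: clean_def expsum_Cons)

lemma resp_clean:
  assumes "respects_eq f" shows "resp (\<lambda>xs. f (map clean xs))"
proof (rule respI)
  fix xs ys assume "list_all2 eqw xs ys"
  then have "list_all2 eqw (map clean xs) (map clean ys)"
    by (auto simp: list_all2_map1 list_all2_map2 eqw_clean elim: list_all2_mono)
  then show "f (map clean xs) = f (map clean ys)"
    using assms unfolding respects_eq_def by simp
qed

lemma resp_imp_respects_eq: "resp f \<Longrightarrow> respects_eq f"
  by (simp add: resp_def respects_eq_def)

lemma tdelta_clean: "tdelta (\<lambda>xs. f (map clean xs)) xs = tdelta f (map clean xs)"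
  by (induction xs arbitrary: f rule: induct_list012) auto

lemma cocycle_clean:
  assumes "cocycle n f" shows "tot_cocycle n (\<lambda>xs. f (map clean xs))"
proof -
  have "f (map clean (tl xs)) + tdelta (\<lambda>xs. f (map clean xs)) xs = 0" if "length xs = n + 1" for xs
  proof -
    have "delta n f (map clean xs) = 0" using assms that by (simp add: cocycle_def)
    then show ?thesis using that by (cases xs) (simp_all add: delta_eq_tdelta tdelta_clean)
  qed
  with assms show ?thesis by (simp add: tot_cocycle_def cocycle_def resp_clean)
qed

lemma tot_cocycle_imp_cocycle:
  assumes "tot_cocycle n f" shows "cocycle n f"
proof -
  have "delta n f xs = 0" if "length xs = n + 1" for xs
    using that tot_cocycleD[OF assms] by (cases xs) (auto simp: delta_eq_tdelta)
  with assms show ?thesis by (simp add: cocycle_def tot_cocycle_def resp_imp_respects_eq)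
qed

lemma tot_coboundary_imp_coboundary:
  assumes "tot_coboundary n g" "n \<ge> 1"
    and "\<And>xs. valid_list xs \<Longrightarrow> length xs = n \<Longrightarrow> g xs = f xs"
  shows "coboundary n f"
proof -
  obtain h where h: "resp h" "\<And>xs. length xs = n \<Longrightarrow> g xs = h (tl xs) + tdelta h xs"
    using assms(1) by (auto simp: tot_coboundary_def)
  have "f xs = delta (n - 1) h xs" if "valid_list xs" "length xs = n" for xs
    using h(2)[OF that(2)] assms(2,3) that by (cases xs) (auto simp: delta_eq_tdelta)
  then show ?thesis using h(1) assms(2) unfolding coboundary_def
    by (intro exI[of _ h]) (auto simp: resp_imp_respects_eq)
qed

lemma coboundary_clean:
  assumes "coboundary n f" "n \<ge> 1"
  shows "tot_coboundary n (\<lambda>xs. f (map clean xs))"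
proof -
  obtain h where h: "respects_eq h"
    "\<And>xs. valid_list xs \<Longrightarrow> length xs = n \<Longrightarrow> f xs = delta (n - 1) h xs"
    using assms by (auto simp: coboundary_def)
  have "f (map clean xs) = h (map clean (tl xs)) + tdelta (\<lambda>xs. h (map clean xs)) xs"
    if "length xs = n" for xs
  proof -
    have "f (map clean xs) = delta (n - 1) h (map clean xs)" by (rule h(2)) (use that in simp_all)
    then show ?thesis
      using that assms(2) by (cases xs) (auto simp: delta_eq_tdelta tdelta_clean)
  qed
  then show ?thesis unfolding tot_coboundary_def
    using resp_clean[OF h(1)] by blast
qed

lemma coboundary_high:
  assumes "cocycle n f" "n \<ge> 3" shows "coboundary n f"
proof (rule tot_coboundary_imp_coboundary)
  show "tot_coboundary n (\<lambda>xs. f (map clean xs))"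
    by (rule tot_coboundary_high[OF cocycle_clean[OF assms(1)] assms(2)])
qed (use assms in \<open>auto simp: map_clean_valid\<close>)

lemma coboundary_eq_0: "(\<And>xs. length xs = n \<Longrightarrow> f xs = 0) \<Longrightarrow> coboundary n f"
  unfolding coboundary_def respects_eq_def
  by (intro exI[of _ "\<lambda>_. 0"]) (auto simp: delta_def)

lemma coboundary_0: "coboundary 0 f \<longleftrightarrow> f [] = 0"
  using coboundary_eq_0[of 0 f] by (auto simp: coboundary_def valid_list_def)

text \<open>With trivial coefficients the coboundary of a 0-cochain is zero.\<close>

lemma coboundary_1: "coboundary 1 f \<longleftrightarrow> (\<forall>x. valid x \<longrightarrow> f [x] = 0)"
proof
  assume "\<forall>x. valid x \<longrightarrow> f [x] = 0"
  then show "coboundary 1 f" unfolding coboundary_def respects_eq_def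
    by (intro exI[of _ "\<lambda>_. 0"]) (auto simp: delta_def length_Suc_conv valid_list_def)
qed (auto simp: coboundary_def delta_def valid_list_def)

section \<open>Monomials in the dual classes\<close>

lemma tdelta_mult: "tdelta (\<lambda>l. c * F l) xs = c * tdelta F xs"
  by (induction xs arbitrary: F rule: induct_list012) (auto simp: algebra_simps)

lemma tot_cocycle_add:
  "tot_cocycle n f \<Longrightarrow> tot_cocycle n g \<Longrightarrow> tot_cocycle n (\<lambda>l. f l + g l)"
  by (force simp: tot_cocycle_def tdelta_add intro: resp_add)

lemma tot_cocycle_diff:
  "tot_cocycle n f \<Longrightarrow> tot_cocycle n g \<Longrightarrow> tot_cocycle n (\<lambda>l. f l - g l)"
  by (force simp: tot_cocycle_def tdelta_diff intro: resp_diff)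

lemma tot_cocycle_mult: "tot_cocycle n f \<Longrightarrow> tot_cocycle n (\<lambda>l. c * f l)"
  unfolding tot_cocycle_def resp_def by (metis distrib_left mult_zero_right tdelta_mult)

lemma tot_cocycle_sum:
  assumes "\<And>i. i \<in> I \<Longrightarrow> tot_cocycle n (F i)"
  shows "tot_cocycle n (\<lambda>l. \<Sum>i\<in>I. c i * F i l)"
  using assms
proof (induction I rule: infinite_finite_induct)
  case (insert i I)
  then show ?case by (simp add: tot_cocycle_add tot_cocycle_mult)
qed (simp_all add: tot_cocycle_def resp_const)

lemma cupmono_Cons [simp]: "cupmono (i # is) (x # xs) = expsum i x * cupmono is xs"
  by (simp add: cup_def dual_def)

lemma cupmono_append:
  "cupmono (is @ js) xs = cupmono is (take (length is) xs) * cupmono js (drop (length is) xs)"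
  by (induction "is" arbitrary: xs) (simp_all add: cup_def dual_def min_def drop_take)

text \<open>The slice at \<open>x\<close> is \<open>expsum i x\<close> times a cocycle, so
  additivity of \<open>expsum i\<close> leaves exactly the term that cancels the face forgetting
  \<open>x\<close>.\<close>

lemma tot_cocycle_cupmono: "tot_cocycle (length is) (cupmono is)"
proof (induction "is")
  case Nil
  show ?case by (auto simp: tot_cocycle_def resp_const length_Suc_conv resp_def)
next
  case (Cons i "is")
  have "resp (cupmono (i # is))"
  proof (rule respI)
    fix xs ys assume "list_all2 eqw xs ys"
    then show "cupmono (i # is) xs = cupmono (i # is) ys"
      using tot_cocycle_resp[OF Cons]
      by (cases xs; cases ys) (auto simp: resp_def expsum_eqw simp del: cupmono.simps(2))
  qed
  moreover have "cupmono (i # is) l + tdelta (cupmono (i # is)) (x # l) = 0"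
    if "length l = Suc (length is)" for x l
  proof -
    obtain y zs where l: "l = y # zs" "length zs = length is" using \<open>length l = Suc (length is)\<close>
      by (cases l) auto
    have "(\<lambda>l. cupmono (i # is) (x # l)) = (\<lambda>l. expsum i x * cupmono is l)"
      by (simp del: cupmono.simps(2))
    then have "tdelta (cupmono (i # is)) (x # y # zs) =
        - (expsum i (x @ y) * cupmono is zs) - expsum i x * tdelta (cupmono is) (y # zs)"
      by (simp add: tdelta_mult del: cupmono.simps(2))
    also have "tdelta (cupmono is) (y # zs) = - cupmono is zs"
      using tot_cocycleD[OF Cons l(2), of y] by simp
    finally have "tdelta (cupmono (i # is)) (x # y # zs) = - (expsum i y * cupmono is zs)"
      by (simp add: left_diff_distrib distrib_right)
    then show ?thesis by (simp add: l del: cupmono.simps(2))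
  qed
  then have "cupmono (i # is) (tl xs) + tdelta (cupmono (i # is)) xs = 0"
    if "length xs = length (i # is) + 1" for xs
    using that by (cases xs) (simp_all del: tdelta.simps cupmono.simps cupmono_Cons)
  ultimately show ?case unfolding tot_cocycle_def by blast
qed

lemma tot_cocycle_phi: "tot_cocycle n (phi n u)"
proof -
  have "tot_cocycle n (cupmono (sorted_list_of_set S))" if "S \<in> {S. S \<subseteq> {0..<5} \<and> card S = n}" for S
    using tot_cocycle_cupmono[of "sorted_list_of_set S"] that by simp
  from tot_cocycle_sum[where I = "{S. S \<subseteq> {0..<5} \<and> card S = n}" and F = "\<lambda>S. cupmono (sorted_list_of_set S)" and c = u, OF this] show ?thesis by (simp add: phi_def[abs_def])
qed

text \<open>The product expands into cup monomials on concatenated, possibly unsorted index lists,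
  all of which are cocycles.\<close>

lemma tot_cocycle_cup_phi: "tot_cocycle (p + q) (cup p (phi p u) (phi q v))"
proof -
  let ?A = "\<lambda>n. {S. S \<subseteq> {0..<5::nat} \<and> card S = n}"
  let ?l = "sorted_list_of_set :: nat set \<Rightarrow> nat list"
  have "tot_cocycle (p + q) (\<lambda>xs. cupmono (?l (fst z) @ ?l (snd z)) xs)" if "z \<in> ?A p \<times> ?A q" for z
    using tot_cocycle_cupmono[of "?l (fst z) @ ?l (snd z)"] that by auto
  from tot_cocycle_sum[where c = "\<lambda>z. u (fst z) * v (snd z)", OF this]
  have "tot_cocycle (p + q) (\<lambda>xs. \<Sum>z\<in>?A p \<times> ?A q. u (fst z) * v (snd z) * cupmono (?l (fst z) @ ?l (snd z)) xs)"
    by simp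
  moreover have "(\<Sum>z\<in>?A p \<times> ?A q. u (fst z) * v (snd z) * cupmono (?l (fst z) @ ?l (snd z)) xs) =
    cup p (phi p u) (phi q v) xs" for xs
  proof -
    have "cup p (phi p u) (phi q v) xs = (\<Sum>S\<in>?A p. \<Sum>R\<in>?A q.
      u S * cupmono (?l S) (take p xs) * (v R * cupmono (?l R) (drop p xs)))"
      by (simp add: cup_def phi_def sum_product)
    also have "\<dots> = (\<Sum>S\<in>?A p. \<Sum>R\<in>?A q. u S * v R * cupmono (?l S @ ?l R) xs)"
      by (intro sum.cong HOL.refl) (auto simp: cupmono_append)
    finally show ?thesis by (simp add: sum.cartesian_product split_def)
  qed
  ultimately show ?thesis by simp
qed

lemma cupmono_clean:
  "set is \<subseteq> {0..<5} \<Longrightarrow> length xs = length is \<Longrightarrow> cupmono is (map clean xs) = cupmono is xs"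
  by (induction "is" arbitrary: xs)
    (auto simp: length_Suc_conv expsum_clean simp del: cupmono.simps(2))

lemma phi_clean:
  assumes "length xs = n"
  shows "phi n u (map clean xs) = phi n u xs"
  unfolding phi_def
proof (rule sum.cong[OF HOL.refl], rule arg_cong[where f = "\<lambda>x. _ * x"], rule cupmono_clean)
  fix S :: "nat set" assume "S \<in> {S. S \<subseteq> {0..<5} \<and> card S = n}"
  moreover from this have "finite S" by (auto intro: finite_subset)
  ultimately show "set (sorted_list_of_set S) \<subseteq> {0..<5}" "length xs = length (sorted_list_of_set S)"
    using assms by auto
qed

section \<open>Cohomology in degrees at most two\<close>

lemma sum_lessThan_5: "(\<Sum>i<5::nat. g i) = g 0 + g 1 + g 2 + g 3 + (g 4 :: int)"
  by (simp add: eval_nat_numeral)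

lemma phi_0: "phi 0 u xs = u {}"
proof -
  have "{S. S \<subseteq> {0..<5::nat} \<and> card S = 0} = {{}}" by (auto dest: finite_subset)
  then show ?thesis by (simp add: phi_def)
qed

lemma phi_1: "phi 1 u [x] = (\<Sum>i<5. u {i} * expsum i x)"
proof -
  have "{S. S \<subseteq> {0..<5::nat} \<and> card S = 1} = (\<lambda>i. {i}) ` {..<5}" by (auto simp: card_1_singleton_iff)
  then show ?thesis by (simp add: phi_def sum.reindex del: cupmono.simps(2))
qed

lemma phi_2:
  "phi 2 u [x, y] =
    u {0, 1} * expsum 0 x * expsum 1 y + u {0, 2} * expsum 0 x * expsum 2 y +
    u {0, 3} * expsum 0 x * expsum 3 y + u {0, 4} * expsum 0 x * expsum 4 y +
    u {1, 2} * expsum 1 x * expsum 2 y + u {1, 3} * expsum 1 x * expsum 3 y +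
    u {1, 4} * expsum 1 x * expsum 4 y + u {2, 3} * expsum 2 x * expsum 3 y +
    u {2, 4} * expsum 2 x * expsum 4 y + u {3, 4} * expsum 3 x * expsum 4 y"
  unfolding phi_def card_2_subsets
  by (simp add: doubleton_eq_iff del: cupmono.simps(2))

text \<open>The coefficients at {0, 2} and {1, 3} drop out, in accordance with \<open>rel3\<close>
  and \<open>rel4\<close>.\<close>

lemma loop_sum_phi_2:
  "loop_sum (phi 2 u) (comm a1 b1) [[]] = u {0, 1}"
  "loop_sum (phi 2 u) (comm a2 b2) [[]] = u {2, 3}"
  "loop_sum (phi 2 u) (eqrel (conj a1 c1) (conj a1 b2)) [[]] = u {0, 4} - u {0, 3}"
  "loop_sum (phi 2 u) (eqrel (conj b1 c1) (conj b1 a2)) [[]] = u {1, 4} - u {1, 2}"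
  "loop_sum (phi 2 u) (eqrel (conj b2 c1) (conj b2 (a1 @ b2))) [[]] = u {3, 4} + u {0, 3}"
  "loop_sum (phi 2 u) (eqrel (conj a2 c1) (conj a2 (b1 @ a2))) [[]] = u {2, 4} + u {1, 2}"
  unfolding loop_sum_def relator_words
  by (simp_all add: tr_def phi_2 expsum_Cons gen_def)

lemma loop_sum_diff: "loop_sum (\<lambda>l. f l - g l) w l = loop_sum f w l - loop_sum g w l"
  unfolding loop_sum_def by (induction w) auto

text \<open>By \<open>tdelta_loop_sum\<close> the loop sum around a relator does not depend on the
  base point, so vanishing at the identity gives vanishing everywhere.\<close>

lemma tot_coboundary_2I:
  assumes f: "tot_cocycle 2 f" and 0: "\<And>r. r \<in> relators \<Longrightarrow> loop_sum f r [[]] = 0"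
  shows "tot_coboundary 2 f"
proof (rule tot_coboundaryI[OF f, where s = "\<lambda>_ _. 0"])
  fix r l assume r: "r \<in> relators" and l: "length (l :: word list) = 2 - 1"
  then obtain z where z: "l = [z]" by (auto simp: length_Suc_conv)
  have "f (tr r [[], z]) = f (tr [] [[], z])"
    by (intro resp_tr[OF tot_cocycle_resp[OF f]]) (use eqw.rel[OF r, of "[]" "[]"] in simp)
  then have "loop_sum f r [z] = 0"
    using tdelta_loop_sum[OF f, of "[[], z]" r] 0[OF r] by simp
  moreover have "psum (\<lambda>_ _. 0) r l = 0" by (induction r) auto
  ultimately show "psum (\<lambda>_ _. 0) r l = loop_sum f r l" by (simp add: z)
qed (simp_all add: resp_const)

text \<open>For the coboundary of \<open>h\<close> the sum telescopes up to one constant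
  \<open>h [gen i]\<close> per signed letter, and these constants cancel since relators have zero
  exponent sums.\<close>

lemma loop_sum_tot_coboundary_2:
  assumes f: "tot_coboundary 2 f" and r: "r \<in> relators"
  shows "loop_sum f r [[]] = 0"
proof -
  obtain h where h: "resp h" "\<And>xs. length xs = 2 \<Longrightarrow> f xs = h (tl xs) + tdelta h xs"
    using f by (auto simp: tot_coboundary_def)
  have fh: "f [x, y] = h [y] - h [x @ y] + h [x]" for x y
    using h(2)[of "[x, y]"] by simp
  have hh: "h [(i, False) # (i, True) # w] = h [w]" for i w
    by (rule respD[OF h(1)]) (use eqw.cancel[of "[]" "(i, False)" w] in \<open>simp add: inv_letter_def\<close>)
  have "loop_sum f w [z] = h [z] - h [w @ z] + psum (\<lambda>i _. h [gen i]) w [z]" for w z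
    unfolding loop_sum_def by (induction w) (auto simp: fh gen_def hh)
  moreover have "psum (\<lambda>i _. h [gen i]) r [[]] = 0"
    using r unfolding relators_explicit by (elim insertE emptyE) simp_all
  moreover have "h [r] = h [[]]"
    by (rule respD[OF h(1)]) (use eqw.rel[OF r, of "[]" "[]"] in simp)
  ultimately show ?thesis by simp
qed

lemma coboundary_2_iff:
  assumes u: "ext_deg 2 u"
  shows "coboundary 2 (phi 2 u) \<longleftrightarrow> ideal_deg 2 u"
proof -
  have "coboundary 2 (phi 2 u) \<longleftrightarrow> tot_coboundary 2 (phi 2 u)"
    using coboundary_clean[of 2 "phi 2 u"] tot_coboundary_imp_coboundary[of 2 "phi 2 u"]
    by (auto simp: tot_coboundary_def phi_clean)
  also have "\<dots> \<longleftrightarrow> (\<forall>r\<in>relators. loop_sum (phi 2 u) r [[]] = 0)"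
    using tot_coboundary_2I[OF tot_cocycle_phi] loop_sum_tot_coboundary_2 by blast
  also have "\<dots> \<longleftrightarrow> ideal_deg 2 u"
    unfolding ideal_deg_2[OF u] relators_def by (auto simp only: ball_simps loop_sum_phi_2)
  finally show ?thesis .
qed

lemma cohomologous_phi_2:
  assumes f: "cocycle 2 f"
  shows "\<exists>u. ext_deg 2 u \<and> cohomologous 2 f (phi 2 u)"
proof -
  define g where "g = (\<lambda>xs. f (map clean xs))"
  have g: "tot_cocycle 2 g" unfolding g_def by (rule cocycle_clean[OF f])
  define L where "L = (\<lambda>r. loop_sum g r [[]])"
  \<comment> \<open>With the coefficients at {0, 3} and {1, 2} set to 0, the six loop sums of
    \<open>phi 2 u\<close> are its six other listed coefficients and can be matched to those of
    \<open>g\<close>.\<close>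
  define u :: ext where "u = (\<lambda>S.
    if S = {0, 1} then L (comm a1 b1)
    else if S = {2, 3} then L (comm a2 b2)
    else if S = {0, 4} then L (eqrel (conj a1 c1) (conj a1 b2))
    else if S = {1, 4} then L (eqrel (conj b1 c1) (conj b1 a2))
    else if S = {3, 4} then L (eqrel (conj b2 c1) (conj b2 (a1 @ b2)))
    else if S = {2, 4} then L (eqrel (conj a2 c1) (conj a2 (b1 @ a2)))
    else 0)"
  have "tot_cocycle 2 (\<lambda>xs. g xs - phi 2 u xs)"
    by (intro tot_cocycle_diff g tot_cocycle_phi)
  moreover have "loop_sum (\<lambda>xs. g xs - phi 2 u xs) r [[]] = 0" if "r \<in> relators" for r
    using that unfolding relators_def loop_sum_diff L_def[symmetric]
    by (elim insertE emptyE; simp only: loop_sum_phi_2; simp add: u_def doubleton_eq_iff L_def)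
  ultimately have "tot_coboundary 2 (\<lambda>xs. g xs - phi 2 u xs)" by (rule tot_coboundary_2I)
  then have "coboundary 2 (\<lambda>xs. f xs - phi 2 u xs)"
    by (rule tot_coboundary_imp_coboundary) (simp_all add: g_def map_clean_valid)
  moreover have "ext_deg 2 u" by (auto simp: ext_deg_def u_def split: if_splits)
  ultimately show ?thesis by (auto simp: cohomologous_def)
qed

section \<open>Degree one: homomorphisms to the integers\<close>

lemma expsum_gen: "expsum i (gen j) = (if i = j then 1 else 0)"
  by (simp add: gen_def expsum_Cons)

lemma valid_gen: "valid (gen i) \<longleftrightarrow> i < 5"
  by (simp add: gen_def valid_def)

lemma coboundary_1_iff:
  assumes u: "ext_deg 1 u"
  shows "coboundary 1 (phi 1 u) \<longleftrightarrow> ideal_deg 1 u"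
proof
  assume *: "coboundary 1 (phi 1 u)"
  have "u S = 0" for S
  proof (rule ccontr)
    assume S: "u S \<noteq> 0"
    then obtain i where i: "S = {i}" "i < 5" using u by (auto simp: ext_deg_def card_1_singleton_iff)
    then have "phi 1 u [gen i] = 0" using * unfolding coboundary_1 by (simp add: valid_gen)
    then show False using i S by (simp add: phi_1[simplified] expsum_gen sum.delta if_distrib cong: if_cong)
  qed
  then show "ideal_deg 1 u" by (simp add: ideal_deg_def)
next
  assume "ideal_deg 1 u"
  then show "coboundary 1 (phi 1 u)" by (intro coboundary_eq_0) (simp add: ideal_deg_def phi_def)
qed

text \<open>A 1-cocycle is a homomorphism and is determined by its values on the generators, which
  become the coefficients.\<close>

lemma cohomologous_phi_1:
  assumes f: "cocycle 1 f"
  shows "\<exists>u. ext_deg 1 u \<and> cohomologous 1 f (phi 1 u)"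
proof -
  define g where "g = (\<lambda>xs. f (map clean xs))"
  have g: "tot_cocycle 1 g" unfolding g_def by (rule cocycle_clean[OF f])
  have hom: "g [x @ y] = g [x] + g [y]" for x y
    using tot_cocycleD[OF g, of "[y]" x] by simp
  have Nil: "g [[]] = 0" using hom[of "[]" "[]"] by simp
  have inv: "g [[(i, True)]] = - g [gen i]" for i
  proof -
    have "g [[(i, False), (i, True)]] = g [[]]"
      by (rule respD[OF tot_cocycle_resp[OF g]])
        (use eqw.cancel[of "[]" "(i, False)" "[]"] in \<open>simp add: inv_letter_def\<close>)
    then show ?thesis using hom[of "gen i" "[(i, True)]"] Nil by (simp add: gen_def)
  qed
  have g_sum: "g [w] = (\<Sum>i<5. g [gen i] * expsum i w)" if "valid w" for w
    using that
  proof (induction w)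
    case (Cons l w)
    obtain i s where l: "l = (i, s)" by force
    have i: "i < 5" and w: "valid w" using Cons.prems by (auto simp: valid_def l)
    have "g [l # w] = g [[l]] + g [w]" using hom[of "[l]" w] by simp
    moreover have "g [[l]] = (if s then -1 else 1) * g [gen i]" using inv[of i] by (simp add: l gen_def)
    moreover have "(\<Sum>k<5. g [gen k] * expsum k (l # w)) =
        (\<Sum>k<5. if k = i then (if s then -1 else 1) * g [gen i] else 0) + (\<Sum>k<5. g [gen k] * expsum k w)"
      unfolding sum.distrib[symmetric] by (rule sum.cong) (auto simp: expsum_Cons l algebra_simps)
    ultimately show ?case using Cons.IH[OF w] i by simp
  qed (simp add: Nil)
  define u :: ext where "u = (\<lambda>S. if \<exists>i<5. S = {i} then g [gen (THE i. S = {i})] else 0)"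
  have "coboundary 1 (\<lambda>xs. f xs - phi 1 u xs)"
    unfolding coboundary_1
  proof (intro allI impI)
    fix x assume x: "valid x"
    have "u {i} = g [gen i]" if "i < 5" for i using that by (auto simp: u_def)
    then have "phi 1 u [x] = (\<Sum>i<5. g [gen i] * expsum i x)" unfolding phi_1 by simp
    then show "f [x] - phi 1 u [x] = 0" using g_sum[OF x] x by (simp add: g_def clean_valid)
  qed
  moreover have "ext_deg 1 u" by (auto simp: ext_deg_def u_def split: if_splits)
  ultimately show ?thesis by (auto simp: cohomologous_def)
qed

section \<open>Products in total degree at most two\<close>

lemma ext_deg_0:
  assumes "ext_deg 0 u" shows "u = mon {} (u {})"
proof
  fix S
  have "S = {}" if "u S \<noteq> 0"
    using assms that finite_subset[of S "{0..<5}"] by (auto simp: ext_deg_def)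
  then show "u S = mon {} (u {}) S" by (auto simp: mon_def)
qed

lemma phi_wedge_0_left:
  assumes "ext_deg 0 u" shows "phi q (wedge u v) xs = cup 0 (phi 0 u) (phi q v) xs"
proof -
  have "wedge u v S = u {} * v S" if "finite S" for S
    using wedge_mon_empty_left[OF that, of "u {}" v] ext_deg_0[OF assms] by simp
  then have "phi q (wedge u v) xs = u {} * phi q v xs"
    unfolding phi_def sum_distrib_left
    by (intro sum.cong HOL.refl) (auto dest: finite_subset)
  then show ?thesis by (simp add: cup_def phi_0)
qed

lemma phi_wedge_0_right:
  assumes "ext_deg 0 v" "length xs = p" shows "phi p (wedge u v) xs = cup p (phi p u) (phi 0 v) xs"
proof -
  have "wedge u v S = u S * v {}" if "finite S" for S
    using wedge_mon[OF that, of u "{}" "v {}"] ext_deg_0[OF assms(1)] by simp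
  then have "phi p (wedge u v) xs = phi p u xs * v {}"
    unfolding phi_def sum_distrib_right
    by (intro sum.cong HOL.refl) (auto dest: finite_subset)
  then show ?thesis using assms(2) by (simp add: cup_def phi_0)
qed

lemma wedge_1_1:
  assumes "ext_deg 1 u" "ext_deg 1 v" "i < j"
  shows "wedge u v {i, j} = u {i} * v {j} - u {j} * v {i}"
proof -
  have z: "u {} = 0" "v {} = 0" using assms by (auto simp: ext_deg_def)
  have "Pow {i, j} = {{}, {i}, {j}, {i, j}}" by auto
  moreover have "{i, j} - {i} = {j}" "{i, j} - {j} = {i}" using assms(3) by auto
  ultimately show ?thesis using assms(3) z
    by (simp add: wedge_def doubleton_eq_iff shuffle_sign_prod)
qed

text \<open>The cup product is not antisymmetric on cochains, so the two cocycles are compared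
  through their loop sums.\<close>

lemma cohomologous_wedge_1_1:
  assumes u: "ext_deg 1 u" and v: "ext_deg 1 v"
  shows "cohomologous 2 (phi 2 (wedge u v)) (cup 1 (phi 1 u) (phi 1 v))"
proof -
  define c where "c = cup 1 (phi 1 u) (phi 1 v)"
  have c: "c [x, y] = (\<Sum>i<5. u {i} * expsum i x) * (\<Sum>i<5. v {i} * expsum i y)" for x y
    by (simp only: phi_1[symmetric]) (simp add: cup_def c_def)
  have "tot_cocycle 2 c"
    using tot_cocycle_cup_phi[of 1 1 u v] unfolding c_def one_add_one .
  then have "tot_cocycle 2 (\<lambda>xs. phi 2 (wedge u v) xs - c xs)"
    by (intro tot_cocycle_diff tot_cocycle_phi)
  moreover have "loop_sum (\<lambda>xs. phi 2 (wedge u v) xs - c xs) r [[]] = 0" if "r \<in> relators" for r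
  proof -
    have "loop_sum c r [[]] = loop_sum (phi 2 (wedge u v)) r [[]]"
      using that unfolding relators_def
      by (elim insertE emptyE; simp only: loop_sum_phi_2; simp only: relator_words loop_sum_def)
        (simp_all add: tr_def c sum_lessThan_5 expsum_Cons gen_def wedge_1_1[OF u v] algebra_simps)
    then show ?thesis by (simp add: loop_sum_diff)
  qed
  ultimately have "tot_coboundary 2 (\<lambda>xs. phi 2 (wedge u v) xs - c xs)"
    by (rule tot_coboundary_2I)
  then show ?thesis unfolding cohomologous_def c_def
    by (rule tot_coboundary_imp_coboundary) simp_all
qed

theorem theorem4p2:
  shows "(\<forall>w v. valid w \<and> valid v \<longrightarrow> (eqab w v \<longleftrightarrow> (\<forall>i<5. expsum i w = expsum i v)))
    \<and> (\<forall>n.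
        (\<forall>u. ext_deg n u \<longrightarrow> cocycle n (phi n u))
      \<and> (\<forall>p q u v. ext_deg p u \<and> ext_deg q v \<and> n = p + q \<longrightarrow>
            cohomologous n (phi n (wedge u v)) (cup p (phi p u) (phi q v)))
      \<and> (\<forall>u. ext_deg n u \<longrightarrow> (coboundary n (phi n u) \<longleftrightarrow> ideal_deg n u))
      \<and> (\<forall>f. cocycle n f \<longrightarrow> (\<exists>u. ext_deg n u \<and> cohomologous n f (phi n u))))"
proof (intro conjI allI impI)
  fix w v assume "valid w \<and> valid v"
  then show "eqab w v \<longleftrightarrow> (\<forall>i<5. expsum i w = expsum i v)" using eqab_iff_expsum by blast
next
  fix n u
  show "cocycle n (phi n u)" by (intro tot_cocycle_imp_cocycle tot_cocycle_phi)
next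
  fix n p q u v assume *: "ext_deg p u \<and> ext_deg q v \<and> n = p + q"
  \<comment> \<open>With a factor of degree 0 the two cochains agree on lists of length
    \<open>n\<close>; in total degree at least 3 both are cocycles, so their difference is a
    coboundary.\<close>
  consider "p = 0" | "q = 0" | "p = 1" "q = 1" | "n \<ge> 3" using * by linarith
  then show "cohomologous n (phi n (wedge u v)) (cup p (phi p u) (phi q v))"
  proof cases
    case 1
    then show ?thesis using * unfolding cohomologous_def
      by (intro coboundary_eq_0) (simp add: phi_wedge_0_left)
  next
    case 2
    then show ?thesis using * unfolding cohomologous_def
      by (intro coboundary_eq_0) (simp add: phi_wedge_0_right)
  next
    case 3
    then show ?thesis using cohomologous_wedge_1_1[of u v] * by (simp add: numeral_2_eq_2)
  next
    case 4
    show ?thesis unfolding cohomologous_def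
      by (intro coboundary_high 4 tot_cocycle_imp_cocycle tot_cocycle_diff tot_cocycle_phi)
        (use * tot_cocycle_cup_phi in blast)
  qed
next
  fix n u assume u: "ext_deg n u"
  consider "n = 0" | "n = 1" | "n = 2" | "n \<ge> 3" by linarith
  then show "coboundary n (phi n u) \<longleftrightarrow> ideal_deg n u"
  proof cases
    case 1
    have "u {} = 0 \<longleftrightarrow> (\<forall>S. u S = 0)" using ext_deg_0[of u] u 1 by (metis mon_def)
    then show ?thesis by (simp add: 1 coboundary_0 phi_0 ideal_deg_def)
  next
    case 4
    then show ?thesis
      using u by (simp add: coboundary_high tot_cocycle_imp_cocycle tot_cocycle_phi ideal_deg_high)
  qed (use u coboundary_1_iff coboundary_2_iff in auto)
next
  fix n f assume f: "cocycle n f"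
  consider "n = 0" | "n = 1" | "n = 2" | "n \<ge> 3" by linarith
  then show "\<exists>u. ext_deg n u \<and> cohomologous n f (phi n u)"
  proof cases
    case 1
    have "ext_deg 0 (mon {} (f []))" by (simp add: ext_deg_mon)
    then show ?thesis unfolding 1 cohomologous_def
      by (intro exI[of _ "mon {} (f [])"]) (simp add: coboundary_0 phi_0 mon_def)
  next
    case 4
    have "ext_deg n (\<lambda>_. 0)" by (simp add: ext_deg_def)
    moreover have "cohomologous n f (phi n (\<lambda>_. 0))"
      using coboundary_high[OF f 4] by (simp add: cohomologous_def phi_def)
    ultimately show ?thesis by blast
  qed (use f cohomologous_phi_1 cohomologous_phi_2 in auto)
qed

end
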